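(* Let $\mu$ be any probability measure on $S^2$ that has a bounded density with respect to the uniform measure, and fix $\xi\in S^2\setminus S_\mu$. Let $p_{N,\xi}$ be the random polynomial of degree $N$ with a deterministic zero at $\xi$ and $N-1$ other zeros $\xi_1,\dots,\xi_{N-1}$ chosen independently from $\mu$. Fix $r>0$, and write $\Gamma_N$ for the geodesic circle of radius $rN^{-1}$ centered at $w_{N,\xi}$. Suppose that $\xi\notin\Gamma_N$ for all $N$. Then, for any $\delta\in(0,1)$, there exists $C=C(r,\delta)>0$ so that for all $N$ $$\mathbb P\left(\exists!\ w\text{ inside }\Gamma_N\ \text{ such that }\ \frac{d}{dw}p_{N,\xi}(w)=0\right)\ \geq\ 1-C\cdot N^{-\delta}.$$ (Here $S_\mu$, $p_{N,\xi}$ and $w_{N,\xi}$ are as defined in the context; $\mu$ and $\xi$ are fixed before $C$ is chosen.)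
   Context: Polynomials of degree at most $N$ in one complex variable are identified with meromorphic functions on the Riemann sphere $S^2$ having a pole at a distinguished point $\infty\in S^2$; $\underline{0}$ denotes the antipodal point to $\infty$. Throughout, $w$ is the usual holomorphic coordinate on $S^2$ centered at $\infty$ (so the point $\infty$ has coordinate $w=0$ and $\underline{0}$ corresponds to $w=\infty$), and points of $S^2$ are identified with their $w$-coordinates. $S^2$ carries its usual round metric with distance $d_{S^2}$; the "uniform measure" is the normalized rotation-invariant measure. "Inside $\Gamma_N$" means in the open geodesic disk bounded by $\Gamma_N$ that contains its center. Random polynomial: given $\xi\in S^2$ and $\mu$, let $[p_{N,\xi}]$ be the random element of the projectivization $\mathbb P(\mathcal P_N)$ of the space $\mathcal P_N$ of polynomials of degree at most $N$, with a deterministic zero at $\xi$ and $N-1$ random zeros $\xi_1,\dots,\xi_{N-1}$ distributed according to the product measure $\mu^{\otimes(N-1)}$ on $(S^2)^{N-1}$. $p_{N,\xi}$ denotes any representative (zeros and critical points do not depend on the choice). In the coordinate $w$, $$p_{N,\xi}(w)=\frac{1}{w^N}(w-\xi)\prod_{j=1}^{N-1}(w-\xi_j).$$ Exceptional set: put $$\phi_\mu(w)=\int_{\mathbb C}\frac{d\mu(\zeta)}{w-\zeta},\qquad S_\mu=\left\{w\ :\ -\frac1w+\phi_\mu(w)\in\{0,\infty\}\right\},$$ where $w$ ranges over all of $S^2$ including $\underline{0}$ (i.e. $w=\infty$, where the expression is $0$); thus $\underline{0},\infty\in S_\mu$. Averaged critical point: for $\xi\in S^2\setminus S_\mu$, $w_{N,\xi}$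 denotes the unique solution of $$\mathbb E\left[\partial_w\log|p_{N,\xi}(w)|^2\right]=0,\quad\text{i.e.}\quad -\frac{N}{w}+\frac{1}{w-\xi}+(N-1)\phi_\mu(w)=0,$$ whose distance from $\xi$ is on the order of $N^{-1}$ (i.e. bounded above and below by positive constants, independent of $N$, times $N^{-1}$). It is defined for all sufficiently large $N$, and "for all $N$" refers to those $N$ for which $w_{N,\xi}$ is defined. *)

theory Defs
  imports "HOL-Probability.Probability"
begin

section \<open>The round sphere\<close>

definition S2 :: "(real^3) set" where
  "S2 = sphere 0 1"

definition sdist :: "real^3 \<Rightarrow> real^3 \<Rightarrow> real" where
  "sdist x y = arccos (x \<bullet> y)"

definition geo_circle :: "real^3 \<Rightarrow> real \<Rightarrow> (real^3) set" where
  "geo_circle c \<rho> = {x \<in> S2. sdist c x = \<rho>}"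

definition geo_disk :: "real^3 \<Rightarrow> real \<Rightarrow> (real^3) set" where
  "geo_disk c \<rho> = {x \<in> S2. sdist c x < \<rho>}"

text \<open>
  The rotation-invariant probability measure on the sphere, obtained as the radial projection of
  the uniform distribution on the unit ball. The origin, which \<^const>\<open>sgn\<close> does not send to the
  sphere, is a null set; see \<open>prob_space_unif_S2\<close> and \<open>unif_S2_rotation_invariant\<close> below.
\<close>

definition unif_S2 :: "(real^3) measure" where
  "unif_S2 = restrict_space (distr (uniform_measure lborel (ball 0 1)) borel sgn) S2"

lemma closed_S2: "closed S2"
  by (simp add: S2_def)

lemma space_unif_S2 [simp]: "space unif_S2 = S2"
  by (simp add: unif_S2_def space_restrict_space)

lemma sets_unif_S2: "sets unif_S2 = sets (restrict_space borel S2)"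
  by (simp add: unif_S2_def sets_restrict_space)

lemma sets_unif_S2_iff: "A \<in> sets unif_S2 \<longleftrightarrow> A \<in> sets borel \<and> A \<subseteq> S2"
  using closed_S2 by (simp add: sets_unif_S2 sets_restrict_space_iff conj_commute)

lemma sgn_measurable: "(sgn :: real^3 \<Rightarrow> real^3) \<in> borel_measurable borel"
  unfolding sgn_div_norm[abs_def] by measurable

lemma emeasure_unif_S2:
  assumes "A \<in> sets unif_S2"
  shows "emeasure unif_S2 A =
    emeasure lborel (ball 0 1 \<inter> sgn -` A) / emeasure lborel (ball (0::real^3) 1)"
proof -
  have A: "A \<in> sets borel" "A \<subseteq> S2"
    using assms by (auto simp: sets_unif_S2_iff)
  have sA: "sgn -` A \<in> sets borel"
    using measurable_sets_borel[OF sgn_measurable A(1)] by simp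
  show ?thesis
    unfolding unif_S2_def
    using A sA sgn_measurable closed_S2
    by (subst emeasure_restrict_space) (auto simp: emeasure_distr)
qed

lemma prob_space_unif_S2: "prob_space unif_S2"
proof
  have "S2 \<in> sets unif_S2"
    using closed_S2 by (simp add: sets_unif_S2_iff)
  moreover have eq: "ball 0 1 \<inter> sgn -` S2 = ball (0::real^3) 1 - {0}"
    by (auto simp: S2_def norm_sgn split: if_splits)
  moreover have "emeasure lborel (ball (0::real^3) 1 - {0}) = emeasure lborel (ball (0::real^3) 1)"
    by (rule emeasure_Diff_null_set) auto
  moreover have "emeasure lborel (ball (0::real^3) 1) \<noteq> 0"
    using less_imp_neq[OF unit_ball_vol_pos[of 3]] by (simp add: emeasure_ball)
  moreover have "emeasure lborel (ball (0::real^3) 1) \<noteq> \<infinity>"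
    using emeasure_lborel_ball_finite[of "0::real^3" 1] by simp
  ultimately show "emeasure unif_S2 (space unif_S2) = 1"
    by (simp add: emeasure_unif_S2 ennreal_divide_self top.not_eq_extremum)
qed

lemma unif_S2_rotation_invariant:
  assumes f: "orthogonal_transformation (f :: real^3 \<Rightarrow> real^3)" and A: "A \<in> sets unif_S2"
  shows "f ` A \<in> sets unif_S2" "emeasure unif_S2 (f ` A) = emeasure unif_S2 A"
proof -
  have inv: "orthogonal_transformation (inv f)" and b: "bij f"
    using f by (auto intro: orthogonal_transformation_inv orthogonal_transformation_bij)
  have Ab: "A \<in> sets borel" "A \<subseteq> S2"
    using A by (auto simp: sets_unif_S2_iff)
  have fA: "f ` A = inv f -` A"
    using b by (simp add: bij_vimage_eq_inv_image bij_imp_bij_inv inv_inv_eq)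
  have m: "inv f \<in> borel_measurable borel"
    using inv by (intro borel_measurable_continuous_onI linear_continuous_on
      linear_conv_bounded_linear[THEN iffD1] orthogonal_transformation_linear)
  have "f ` A \<in> sets borel"
    using measurable_sets_borel[OF m Ab(1)] by (simp add: fA)
  moreover have "f ` A \<subseteq> S2"
    using Ab(2) f by (auto simp: S2_def orthogonal_transformation_norm)
  ultimately show *: "f ` A \<in> sets unif_S2"
    by (simp add: sets_unif_S2_iff)
  define B where "B = ball 0 1 \<inter> sgn -` A"
  have sf: "sgn (f x) = f (sgn x)" for x
    using f orthogonal_transformation_linear[OF f]
    by (simp add: sgn_div_norm orthogonal_transformation_norm linear_cmul)
  have fB: "ball 0 1 \<inter> sgn -` (f ` A) = f ` B"
  proof (intro set_eqI iffI)
    fix y assume y: "y \<in> ball 0 1 \<inter> sgn -` (f ` A)"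
    obtain x where x: "y = f x" using b by (metis bij_pointE)
    show "y \<in> f ` B"
      using y b f by (auto simp: x B_def sf inj_image_mem_iff bij_is_inj orthogonal_transformation_norm)
  qed (use f in \<open>auto simp: B_def sf orthogonal_transformation_norm\<close>)
  have sets: "sgn -` A \<in> sets borel" "sgn -` (f ` A) \<in> sets borel"
    using measurable_sets_borel[OF sgn_measurable] Ab(1) \<open>f ` A \<in> sets borel\<close> by auto
  have Bs: "B \<in> sets borel" "f ` B \<in> sets borel"
    using sets by (simp_all add: B_def flip: fB[unfolded B_def])
  have lm: "B \<in> lmeasurable"
    using Bs(1) by (intro bounded_set_imp_lmeasurable) (auto simp: B_def intro: bounded_subset)
  have "emeasure lebesgue (f ` B) = emeasure lebesgue B"
    using measure_orthogonal_image[OF f lm] measurable_orthogonal_image[OF f lm] lm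
    by (simp add: emeasure_eq_measure2)
  then have "emeasure lborel (f ` B) = emeasure lborel B"
    using Bs by simp
  then show "emeasure unif_S2 (f ` A) = emeasure unif_S2 A"
    using emeasure_unif_S2[OF *] emeasure_unif_S2[OF A] by (simp add: fB) (simp add: B_def)
qed

definition has_bounded_density :: "(real^3) measure \<Rightarrow> bool" where
  "has_bounded_density \<mu> \<longleftrightarrow>
    (\<exists>f \<in> borel_measurable unif_S2. \<exists>B::real.
       (\<forall>x\<in>S2. 0 \<le> f x \<and> f x \<le> B) \<and> \<mu> = density unif_S2 (\<lambda>x. ennreal (f x)))"

section \<open>The coordinate centred at infinity\<close>

text \<open>
  \<open>pole_pt\<close> is the distinguished point \<open>\<infinity>\<close>, where \<open>w = 0\<close> and where polynomials have their pole;
  \<open>origin_pt\<close> is its antipode, where \<open>w = \<infinity>\<close>. The coordinate \<open>w\<close> is stereographic projection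
  from \<open>origin_pt\<close>. Since division by zero gives \<open>wcoord origin_pt = 0\<close>, every use of \<open>wcoord\<close>
  below treats \<open>origin_pt\<close> separately.
\<close>

definition pole_pt :: "real^3" where
  "pole_pt = vector [0, 0, -1]"

definition origin_pt :: "real^3" where
  "origin_pt = vector [0, 0, 1]"

definition wcoord :: "real^3 \<Rightarrow> complex" where
  "wcoord x = Complex (x $ 1) (x $ 2) / of_real (1 - x $ 3)"

section \<open>The exceptional set, the random polynomial and the averaged critical point\<close>

definition phi :: "(real^3) measure \<Rightarrow> complex \<Rightarrow> complex" where
  "phi \<mu> w = (LINT \<zeta>:(S2 - {origin_pt})|\<mu>. 1 / (w - wcoord \<zeta>))"

text \<open>
  The set where \<open>- 1/w + phi \<mu> w\<close> is \<open>0\<close> or \<open>\<infinity>\<close>. For \<open>\<mu>\<close> with bounded density the integral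
  defining \<open>phi \<mu> w\<close> converges absolutely for every \<open>w \<in> \<complex>\<close>, so that the value \<open>\<infinity>\<close> is taken only
  at \<open>w = 0\<close>; at \<open>w = \<infinity>\<close> the value is \<open>0\<close>.
\<close>

definition exceptional_set :: "(real^3) measure \<Rightarrow> (real^3) set" where
  "exceptional_set \<mu> = {pole_pt, origin_pt} \<union>
     {x \<in> S2 - {pole_pt, origin_pt}. - 1 / wcoord x + phi \<mu> (wcoord x) = 0}"

text \<open>
  The linear factor with zero at \<open>x\<close>. A zero at \<open>w = \<infinity>\<close> contributes the factor \<open>1\<close>: in the
  coordinate \<open>z = 1/w\<close> one has \<open>(w - a) / w = 1 - a z\<close>, whose class in projective space tends to
  that of \<open>z = 1/w\<close> as \<open>a\<close> tends to \<open>\<infinity>\<close>.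
\<close>

definition lin_factor :: "real^3 \<Rightarrow> complex \<Rightarrow> complex" where
  "lin_factor x w = (if x = origin_pt then 1 else w - wcoord x)"

definition rpoly :: "nat \<Rightarrow> real^3 \<Rightarrow> (nat \<Rightarrow> real^3) \<Rightarrow> complex \<Rightarrow> complex" where
  "rpoly N \<xi> zs w = 1 / w ^ N * lin_factor \<xi> w * (\<Prod>j=1..N-1. lin_factor (zs j) w)"

definition is_critical_point :: "nat \<Rightarrow> real^3 \<Rightarrow> (nat \<Rightarrow> real^3) \<Rightarrow> real^3 \<Rightarrow> bool" where
  "is_critical_point N \<xi> zs x \<longleftrightarrow>
     x \<in> S2 - {pole_pt, origin_pt} \<and> deriv (rpoly N \<xi> zs) (wcoord x) = 0"

text \<open>
  \<open>W N\<close>, for \<open>N\<close> in the set \<open>D\<close> of indices at which it is defined, solves the averaged critical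
  point equation, at a distance from \<open>\<xi>\<close> of order exactly \<open>1/N\<close>.
\<close>

definition averaged_critical_point ::
    "(real^3) measure \<Rightarrow> real^3 \<Rightarrow> nat set \<Rightarrow> (nat \<Rightarrow> real^3) \<Rightarrow> bool" where
  "averaged_critical_point \<mu> \<xi> D W \<longleftrightarrow>
     (\<forall>\<^sub>F N in sequentially. N \<in> D) \<and>
     (\<forall>N\<in>D. N \<ge> 1 \<and> W N \<in> S2 - {pole_pt, origin_pt, \<xi>} \<and>
        - of_nat N / wcoord (W N) + 1 / (wcoord (W N) - wcoord \<xi>)
          + of_nat (N - 1) * phi \<mu> (wcoord (W N)) = 0) \<and>
     (\<exists>a>0. \<exists>b>0. \<forall>N\<in>D. a / real N \<le> sdist (W N) \<xi> \<and> sdist (W N) \<xi> \<le> b / real N)"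

end

theory Submission
  imports Defs "HOL-Complex_Analysis.Cauchy_Integral_Formula" "HOL-Real_Asymp.Real_Asymp"
begin

text \<open>
  Write \<open>x\<^sub>0\<close> for the coordinate of \<open>\<xi>\<close> and \<open>a = - 1 / x\<^sub>0 + phi \<mu> x\<^sub>0\<close>. Away from the random zeros, the
  critical points are the solutions of \<open>1 + N (w - x\<^sub>0) A w = 0\<close>, where
  \<open>A w = - 1 / w + (1 / N) (\<Sum>j. 1 / (w - \<xi>\<^sub>j))\<close>. In this form the pole at \<open>x\<^sub>0\<close> has disappeared, and the
  equation says that \<open>w\<close> is a fixed point of \<open>w \<mapsto> x\<^sub>0 - 1 / (N A w)\<close>. If no random zero lies within
  \<open>4 R / N\<close> of \<open>\<xi>\<close>, if \<open>\<Sum>j. 1 / \<bar>\<xi> - \<xi>\<^sub>j\<bar>\<^sup>2\<close> is a small multiple of \<open>N\<^sup>2\<close>, and if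
  \<open>(1 / N) (\<Sum>j. 1 / (x\<^sub>0 - \<xi>\<^sub>j))\<close> is close to \<open>phi \<mu> x\<^sub>0\<close>, then this map is a contraction of the disk of
  radius \<open>R / N\<close> about \<open>x\<^sub>0\<close>, with its fixed point close to \<open>x\<^sub>0 - 1 / (N a)\<close>; since \<open>phi \<mu>\<close> is continuous, the
  averaged critical point is close to that point too.

  A bounded density gives disks of radius \<open>t\<close> mass \<open>O(t\<^sup>2)\<close>, so \<open>\<bar>\<xi> - \<zeta>\<bar>\<close> has finite moments of every order
  greater than \<open>- 2\<close>. Truncated at distance \<open>1 / N\<close>, the moment of order \<open>- 2\<close> is therefore
  \<open>O(N powr (1 - \<delta>))\<close>, and the inequalities of Markov and Chebyshev bound the probability that one of the
  three conditions fails by \<open>O(N powr (- \<delta>))\<close>.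
\<close>

section \<open>The round sphere in the stereographic coordinate\<close>

lemma S2_iff: "x \<in> S2 \<longleftrightarrow> (x $ 1)\<^sup>2 + (x $ 2)\<^sup>2 + (x $ 3)\<^sup>2 = 1"
  by (simp add: S2_def norm_eq_1 inner_vec_def sum_3 power2_eq_square)

lemma S2_inner_self: "x \<in> S2 \<Longrightarrow> x \<bullet> x = 1"
  by (simp add: S2_def norm_eq_1)

lemma S2_eq_origin_iff:
  assumes "x \<in> S2"
  shows "x = origin_pt \<longleftrightarrow> x $ 3 = 1"
proof
  assume *: "x $ 3 = 1"
  then have "(x $ 1)\<^sup>2 + (x $ 2)\<^sup>2 = 0"
    using assms by (simp add: S2_iff)
  then have "x $ 1 = 0" "x $ 2 = 0"
    by (simp_all add: sum_power2_eq_zero_iff)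
  with * show "x = origin_pt"
    by (simp add: origin_pt_def vec_eq_iff forall_3)
qed (simp add: origin_pt_def)

lemma S2_third_le_1: "x \<in> S2 \<Longrightarrow> x $ 3 \<le> 1" "x \<in> S2 \<Longrightarrow> - 1 \<le> x $ 3"
  using abs_le_square_iff[of "x $ 3" 1] by (auto simp: S2_iff) (smt (verit) zero_le_power2)+

lemma S2_third_less_1: "x \<in> S2 \<Longrightarrow> x \<noteq> origin_pt \<Longrightarrow> x $ 3 < 1"
  using S2_third_le_1[of x] S2_eq_origin_iff[of x] by linarith

lemma origin_pt_in_S2: "origin_pt \<in> S2" and pole_pt_in_S2: "pole_pt \<in> S2"
  by (simp_all add: S2_iff origin_pt_def pole_pt_def)

lemma pole_pt_neq_origin_pt: "pole_pt \<noteq> origin_pt"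
  by (simp add: origin_pt_def pole_pt_def vec_eq_iff forall_3)

lemma wcoord_pole_pt: "wcoord pole_pt = 0"
  by (simp add: wcoord_def pole_pt_def complex_eq_iff)

lemma S2_norm_diff_sq: 
  assumes "x \<in> S2" "y \<in> S2"
  shows "(norm (x - y))\<^sup>2 = 2 - 2 * (x \<bullet> y)"
  using assms by (simp add: power2_norm_eq_inner inner_diff inner_commute S2_inner_self)

text \<open>With \<open>a = 1 - x $ 3\<close>, membership in the sphere reads
  \<open>(x $ 1)\<^sup>2 + (x $ 2)\<^sup>2 = a * (2 - a)\<close>. Expanding the squared coordinate
  distance and inserting this for both points leaves \<open>2 - 2 * (x \<bullet> y)\<close>, the
  squared chord.\<close>

lemma chordal_identity:
  assumes x: "x \<in> S2 - {origin_pt}" and y: "y \<in> S2 - {origin_pt}"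
  shows "(norm (x - y))\<^sup>2 = (1 - x $ 3) * (1 - y $ 3) * (cmod (wcoord x - wcoord y))\<^sup>2"
proof -
  have nz: "1 - x $ 3 \<noteq> 0" "1 - y $ 3 \<noteq> 0"
    using S2_third_less_1[of x] S2_third_less_1[of y] x y by auto
  define a b where "a = 1 - x $ 3" and "b = 1 - y $ 3"
  have w: "wcoord x - wcoord y =
      Complex (x $ 1 / a - y $ 1 / b) (x $ 2 / a - y $ 2 / b)"
    by (simp add: wcoord_def a_def b_def complex_eq_iff)
  have sx: "(x $ 1)\<^sup>2 + (x $ 2)\<^sup>2 = a * (2 - a)" and sy: "(y $ 1)\<^sup>2 + (y $ 2)\<^sup>2 = b * (2 - b)"
    using x y by (auto simp: S2_iff a_def b_def power2_eq_square algebra_simps)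
  have ab: "a \<noteq> 0" "b \<noteq> 0" using nz by (auto simp: a_def b_def)
  have "a * b * (cmod (wcoord x - wcoord y))\<^sup>2 =
      a * b * ((x $ 1 / a - y $ 1 / b)\<^sup>2 + (x $ 2 / a - y $ 2 / b)\<^sup>2)"
    by (simp add: w cmod_power2)
  also have "\<dots> = b * ((x $ 1)\<^sup>2 + (x $ 2)\<^sup>2) / a + a * ((y $ 1)\<^sup>2 + (y $ 2)\<^sup>2) / b
      - 2 * (x $ 1 * y $ 1 + x $ 2 * y $ 2)"
    using ab by (simp add: field_simps power2_eq_square)
  also have "\<dots> = b * (2 - a) + a * (2 - b) - 2 * (x $ 1 * y $ 1 + x $ 2 * y $ 2)"
    using ab by (simp add: sx sy)
  also have "\<dots> = 2 - 2 * (x \<bullet> y)"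
    by (simp add: inner_vec_def sum_3 a_def b_def algebra_simps)
  finally show ?thesis
    using x y by (simp add: S2_norm_diff_sq a_def b_def)
qed

text \<open>Both conformal factors \<open>1 - x $ 3\<close> and \<open>1 - y $ 3\<close> are at most
  2. This direction holds uniformly on the punctured sphere; \<open>wcoord_Lipschitz\<close> gives
  the reverse one away from \<open>origin_pt\<close>.\<close>

lemma norm_le_wcoord:
  assumes x: "x \<in> S2 - {origin_pt}" and y: "y \<in> S2 - {origin_pt}"
  shows "norm (x - y) \<le> 2 * cmod (wcoord x - wcoord y)"
proof -
  have "(1 - x $ 3) * (1 - y $ 3) \<le> 2 * 2"
    using S2_third_le_1[of x] S2_third_le_1[of y] x y by (intro mult_mono) auto
  then have "(norm (x - y))\<^sup>2 \<le> (2 * 2) * (cmod (wcoord x - wcoord y))\<^sup>2"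
    unfolding chordal_identity[OF x y] by (intro mult_right_mono) auto
  also have "\<dots> = (2 * cmod (wcoord x - wcoord y))\<^sup>2"
    by (simp add: power_mult_distrib)
  finally show ?thesis
    by (rule power2_le_imp_le) simp
qed

lemma wcoord_eq_iff:
  assumes x: "x \<in> S2 - {origin_pt}" and y: "y \<in> S2 - {origin_pt}"
  shows "wcoord x = wcoord y \<longleftrightarrow> x = y"
  using norm_le_wcoord[OF x y] by auto

lemma wcoord_eq_0_iff:
  assumes "x \<in> S2 - {origin_pt}"
  shows "wcoord x = 0 \<longleftrightarrow> x = pole_pt"
  using wcoord_eq_iff[OF assms, of pole_pt] pole_pt_in_S2 pole_pt_neq_origin_pt
  by (simp add: wcoord_pole_pt)

lemma wcoord_surj:
  obtains x where "x \<in> S2 - {origin_pt}" "wcoord x = w"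
proof
  \<comment> \<open>The witness is inverse stereographic projection, written with \<open>m\<close>
    equal to 1 plus the squared modulus of \<open>w\<close>.\<close>
  define m where "m = (cmod w)\<^sup>2 + 1"
  have m: "m > 0" "m = (Re w)\<^sup>2 + (Im w)\<^sup>2 + 1"
    by (auto simp: m_def cmod_power2 add_nonneg_pos)
  define x :: "real^3" where "x = vector [2 * Re w / m, 2 * Im w / m, 1 - 2 / m]"
  have "(2 * Re w / m)\<^sup>2 + (2 * Im w / m)\<^sup>2 + (1 - 2 / m)\<^sup>2 = (4 * ((Re w)\<^sup>2 + (Im w)\<^sup>2) + (m - 2)\<^sup>2) / m\<^sup>2"
    using m(1) by (simp add: field_simps power2_eq_square)
  also have "4 * ((Re w)\<^sup>2 + (Im w)\<^sup>2) = 4 * (m - 1)"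
    using m(2) by simp
  also have "(4 * (m - 1) + (m - 2)\<^sup>2) / m\<^sup>2 = 1"
    using m(1) by (simp add: field_simps power2_eq_square)
  finally show "x \<in> S2 - {origin_pt}"
    using m(1) by (auto simp: S2_iff S2_eq_origin_iff x_def)
  show "wcoord x = w"
    using m(1) by (simp add: wcoord_def x_def complex_eq_iff)
qed

section \<open>Comparison of geodesic, chordal and coordinate distances\<close>

lemma S2_inner_bounds:
  assumes "x \<in> S2" "y \<in> S2"
  shows "-1 \<le> x \<bullet> y" "x \<bullet> y \<le> 1"
  using Cauchy_Schwarz_ineq2[of x y] assms by (auto simp: S2_def)

text \<open>Up to \<open>pi / 3\<close> the derivative \<open>cos\<close> is at least 1/2; beyond
  that \<open>sin t\<close> is at least \<open>sqrt 3 / 2\<close>, which exceeds the largest value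
  \<open>pi / 4\<close> of the left side.\<close>

lemma sin_ge_half:
  assumes "0 \<le> t" "t \<le> pi / 2"
  shows "t / 2 \<le> sin t"
proof (cases "t \<le> pi / 3")
  case True
  have "cos (pi / 3) \<le> cos s" if "0 \<le> s" "s \<le> t" for s
    using that True by (intro cos_monotone_0_pi_le) auto
  then have *: "1 \<le> cos s * 2" if "0 \<le> s" "s \<le> t" for s
    using that by (simp add: cos_60)
  have "sin 0 - 0 / 2 \<le> sin t - t / 2"
    using assms(1)
    by (rule DERIV_nonneg_imp_nondecreasing) (auto intro!: exI derivative_eq_intros simp: *)
  then show ?thesis by simp
next
  case False
  have "t / 2 \<le> pi / 4" using assms by simp
  also have "\<dots> \<le> sqrt 3 / 2"
  proof -
    have "pi \<le> 2 * (17 / 10)" using pi_less_4 pi_approx by simp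
    also have "17 / 10 \<le> sqrt 3" by (rule real_le_rsqrt) (simp add: power2_eq_square)
    finally show ?thesis by simp
  qed
  also have "\<dots> = sin (pi / 3)" by (simp add: sin_60)
  also have "\<dots> \<le> sin t" using False assms by (intro sin_monotone_2pi_le) auto
  finally show ?thesis .
qed

text \<open>This is the half-angle formula \<open>cos (2 * s) = 1 - 2 * (sin s)\<^sup>2\<close>,
  applied with \<open>s\<close> half the geodesic distance. Together with bounds on the sine it
  makes chord and arc comparable up to a factor 2.\<close>

lemma norm_eq_sin_sdist:
  assumes "x \<in> S2" "y \<in> S2"
  shows "norm (x - y) = 2 * sin (sdist x y / 2)" "0 \<le> sdist x y" "sdist x y \<le> pi"
proof -
  note b = S2_inner_bounds[OF assms]
  show d: "0 \<le> sdist x y" "sdist x y \<le> pi"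
    using b by (auto simp: sdist_def arccos_lbound arccos_ubound)
  have "x \<bullet> y = cos (2 * (sdist x y / 2))"
    using b by (simp add: sdist_def)
  also have "\<dots> = 1 - 2 * (sin (sdist x y / 2))\<^sup>2"
    by (rule cos_double_sin)
  finally have "(norm (x - y))\<^sup>2 = (2 * sin (sdist x y / 2))\<^sup>2"
    by (simp add: S2_norm_diff_sq assms power_mult_distrib)
  then show "norm (x - y) = 2 * sin (sdist x y / 2)"
    by (rule power2_eq_imp_eq) (use d in \<open>auto intro: sin_ge_zero\<close>)
qed

lemma norm_le_sdist:
  assumes "x \<in> S2" "y \<in> S2"
  shows "norm (x - y) \<le> sdist x y"
  using norm_eq_sin_sdist[OF assms] sin_x_le_x[of "sdist x y / 2"] by simp

lemma sdist_le_norm: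
  assumes "x \<in> S2" "y \<in> S2"
  shows "sdist x y \<le> 2 * norm (x - y)"
  using norm_eq_sin_sdist[OF assms] sin_ge_half[of "sdist x y / 2"] by simp

lemma wcoord_Lipschitz:
  assumes x: "x \<in> S2 - {origin_pt}" and y: "y \<in> S2 - {origin_pt}"
    and c: "0 < c" "c \<le> 1 - x $ 3" "c \<le> 1 - y $ 3"
  shows "cmod (wcoord x - wcoord y) \<le> norm (x - y) / c"
proof -
  have "(c * cmod (wcoord x - wcoord y))\<^sup>2 = c * c * (cmod (wcoord x - wcoord y))\<^sup>2"
    by (simp add: power2_eq_square)
  also have "\<dots> \<le> (1 - x $ 3) * (1 - y $ 3) * (cmod (wcoord x - wcoord y))\<^sup>2"
    using c by (intro mult_right_mono mult_mono) auto
  also have "\<dots> = (norm (x - y))\<^sup>2"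
    by (simp add: chordal_identity[OF x y])
  finally have "c * cmod (wcoord x - wcoord y) \<le> norm (x - y)"
    by (rule power2_le_imp_le) simp
  then show ?thesis using c by (simp add: field_simps)
qed

section \<open>Measures with bounded density\<close>

lemma cap_measurable: "{z \<in> S2. norm (x - z) \<le> t} \<in> sets unif_S2"
proof -
  have "closed ({z. norm (x - z) \<le> t} \<inter> S2)"
    by (intro closed_Int closed_S2 closed_Collect_le continuous_intros)
  moreover have "{z. norm (x - z) \<le> t} \<inter> S2 = {z \<in> S2. norm (x - z) \<le> t}"
    by auto
  ultimately show ?thesis
    by (simp add: sets_unif_S2_iff borel_closed)
qed

text \<open>For a cap about \<open>origin_pt\<close>, the points of the unit ball that project into
  it have their first two coordinates bounded by \<open>t\<close>, since scaling to norm at most 1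
  does not enlarge coordinates. They lie in a box of volume \<open>8 * t\<^sup>2\<close>. A rotation
  carries the bound to any other centre.\<close>

lemma emeasure_cap_le:
  obtains K :: real where "K > 0"
    "\<And>x t. x \<in> S2 \<Longrightarrow> t \<ge> 0 \<Longrightarrow> emeasure unif_S2 {z \<in> S2. norm (x - z) \<le> t} \<le> ennreal (K * t\<^sup>2)"
proof -
  define V where "V = unit_ball_vol 3"
  have V: "V > 0" "emeasure lborel (ball (0::real^3) 1) = ennreal V"
    using unit_ball_vol_pos[of 3] by (simp_all add: V_def emeasure_ball)
  have o: "emeasure unif_S2 {z \<in> S2. norm (origin_pt - z) \<le> t} \<le> ennreal (8 / V * t\<^sup>2)"
    if t: "t \<ge> 0" for t
  proof -
    define A where "A = {z \<in> S2. norm (origin_pt - z) \<le> t}"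
    define l u :: "real^3" where "l = vector [-t, -t, -1]" and "u = vector [t, t, 1]"
    have le: "l $ i \<le> u $ i" for i
      using t exhaust_3[of i] by (auto simp: l_def u_def)
    have sub: "ball 0 1 \<inter> sgn -` A \<subseteq> cbox l u"
    proof
      fix y :: "real^3" assume y: "y \<in> ball 0 1 \<inter> sgn -` A"
      then have n: "norm y \<le> 1" "norm (origin_pt - sgn y) \<le> t"
        by (auto simp: A_def)
      have *: "\<bar>y $ i\<bar> \<le> t" if "origin_pt $ i = 0" for i
      proof -
        have "\<bar>sgn y $ i\<bar> \<le> t"
          using component_le_norm_cart[of "origin_pt - sgn y" i] n(2) that by simp
        moreover have "\<bar>y $ i\<bar> = norm y * \<bar>sgn y $ i\<bar>"
          by (cases "y = 0") (simp_all add: sgn_div_norm abs_mult)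
        moreover have "norm y * \<bar>sgn y $ i\<bar> \<le> 1 * \<bar>sgn y $ i\<bar>"
          using n(1) by (intro mult_right_mono) auto
        ultimately show ?thesis by simp
      qed
      have "\<bar>y $ 3\<bar> \<le> 1"
        using component_le_norm_cart[of y 3] n(1) by simp
      with *[of 1] *[of 2] show "y \<in> cbox l u"
        by (auto simp: mem_box_cart forall_3 l_def u_def origin_pt_def abs_le_iff)
    qed
    have "emeasure lborel (ball 0 1 \<inter> sgn -` A) \<le> emeasure lborel (cbox l u)"
      using sub by (intro emeasure_mono) auto
    also have "emeasure lborel (cbox l u) = ennreal (measure lborel (cbox l u))"
      by (intro emeasure_eq_ennreal_measure) (use emeasure_lborel_cbox_finite[of l u] in auto)
    also have "measure lborel (cbox l u) = (\<Prod>i\<in>UNIV. u $ i - l $ i)"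
      using le by (simp add: content_cbox_cart interval_ne_empty_cart)
    also have "\<dots> = 8 * t\<^sup>2"
      unfolding UNIV_3 by (simp add: l_def u_def power2_eq_square)
    finally have "emeasure lborel (ball 0 1 \<inter> sgn -` A) \<le> ennreal (8 * t\<^sup>2)" .
    then have "emeasure unif_S2 A \<le> ennreal (8 * t\<^sup>2) / ennreal V"
      using cap_measurable[of origin_pt t] unfolding A_def
      by (subst emeasure_unif_S2) (auto simp: V intro!: divide_right_mono_ennreal)
    then show ?thesis
      using V(1) by (simp add: A_def divide_ennreal)
  qed
  have g: "emeasure unif_S2 {z \<in> S2. norm (x - z) \<le> t} \<le> ennreal (8 / V * t\<^sup>2)"
    if x: "x \<in> S2" and t: "t \<ge> 0" for x t
  proof -
    obtain f where f: "orthogonal_transformation f" "f origin_pt = x"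
      using orthogonal_transformation_exists_1[of origin_pt x] x origin_pt_in_S2
      by (auto simp: S2_def)
    have lin: "linear f" using f(1) by (rule orthogonal_transformation_linear)
    have "{z \<in> S2. norm (x - z) \<le> t} = f ` {z \<in> S2. norm (origin_pt - z) \<le> t}" (is "?l = f ` ?r")
    proof (intro equalityI subsetI)
      fix z assume z: "z \<in> ?l"
      obtain y where y: "z = f y"
        using orthogonal_transformation_bij[OF f(1)] by (metis bij_pointE)
      then show "z \<in> f ` ?r"
        using z f(1) by (auto simp: S2_def orthogonal_transformation_norm
            simp flip: f(2) linear_diff[OF lin])
    qed (use f(1) in \<open>auto simp: S2_def orthogonal_transformation_norm
            simp flip: f(2) linear_diff[OF lin]\<close>)
    then show ?thesis
      using unif_S2_rotation_invariant(2)[OF f(1) cap_measurable] o[OF t] by simp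
  qed
  show ?thesis
    by (rule that[of "8 / V"]) (use V g in auto)
qed

section \<open>Dyadic scales and moments of the distance to a point\<close>

lemma dyadic_scale:
  fixes t :: real
  assumes "0 < t" "t \<le> 2"
  obtains k :: nat where "(1/2)^k < t" "t \<le> 2 * (1/2)^k"
proof -
  define P where "P k \<longleftrightarrow> (1/2::real)^k < t" for k
  have ex: "\<exists>k. P k"
    using real_arch_pow_inv[OF assms(1), of "1/2"] by (auto simp: P_def)
  define k where "k = (LEAST k. P k)"
  have k: "P k"
    unfolding k_def using ex by (rule LeastI_ex)
  \<comment> \<open>Minimality of \<open>k\<close> gives the bound at the preceding scale; for
    \<open>k = 0\<close> it is the assumption that \<open>t\<close> is at most 2, the diameter of
    the sphere.\<close>
  have "t \<le> 2 * (1/2)^k"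
  proof (cases k)
    case (Suc m)
    then have "\<not> P m"
      using not_less_Least[of m P] by (simp add: k_def)
    then show ?thesis by (simp add: Suc P_def)
  qed (use assms in simp)
  with k show ?thesis by (intro that) (auto simp: P_def)
qed

text \<open>The quadratic bound on the mass of caps is the form in which the bounded density enters
  all later estimates.\<close>

locale S2_measure = prob_space \<mu> for \<mu> :: "(real^3) measure" +
  fixes K :: real
  assumes sets_eq: "sets \<mu> = sets unif_S2"
    and cap_bound: "\<And>x t. x \<in> S2 \<Longrightarrow> t \<ge> 0 \<Longrightarrow>
      emeasure \<mu> {z \<in> S2. norm (x - z) \<le> t} \<le> ennreal (K * t\<^sup>2)"
    and K_pos: "K > 0"

lemma has_bounded_density_S2_measure:
  assumes "prob_space \<mu>" "has_bounded_density \<mu>"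
  obtains K where "S2_measure \<mu> K"
proof -
  obtain f B where f: "f \<in> borel_measurable unif_S2" "\<forall>x\<in>S2. 0 \<le> f x \<and> f x \<le> B"
      "\<mu> = density unif_S2 (\<lambda>x. ennreal (f x))"
    using assms(2) by (auto simp: has_bounded_density_def)
  obtain K where K: "K > 0" "\<And>x t. x \<in> S2 \<Longrightarrow> t \<ge> 0 \<Longrightarrow>
      emeasure unif_S2 {z \<in> S2. norm (x - z) \<le> t} \<le> ennreal (K * t\<^sup>2)"
    using emeasure_cap_le by blast
  have B: "B \<ge> 0" using f(2) origin_pt_in_S2 by fastforce
  \<comment> \<open>Using \<open>B + 1\<close> instead of \<open>B\<close> makes the constant
    visibly positive, as \<open>K_pos\<close> demands.\<close>
  have "emeasure \<mu> {z \<in> S2. norm (x - z) \<le> t} \<le> ennreal ((B + 1) * K * t\<^sup>2)"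
    if "x \<in> S2" "t \<ge> 0" for x t
  proof -
    define A where "A = {z \<in> S2. norm (x - z) \<le> t}"
    have A: "A \<in> sets unif_S2" unfolding A_def by (rule cap_measurable)
    have "emeasure \<mu> A = (\<integral>\<^sup>+z. ennreal (f z) * indicator A z \<partial>unif_S2)"
      using A f by (simp add: emeasure_density)
    also have "\<dots> \<le> (\<integral>\<^sup>+z. ennreal (B + 1) * indicator A z \<partial>unif_S2)"
      using f(2) by (intro nn_integral_mono mult_right_mono ennreal_leI) fastforce+
    also have "\<dots> = ennreal (B + 1) * emeasure unif_S2 A"
      using A by (simp add: nn_integral_cmult_indicator)
    also have "\<dots> \<le> ennreal (B + 1) * ennreal (K * t\<^sup>2)"
      using K(2)[OF that] by (intro mult_left_mono) (auto simp: A_def)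
    finally show ?thesis
      unfolding A_def using B K(1) by (subst (asm) ennreal_mult[symmetric]) (auto simp: mult.assoc)
  qed
  then have "S2_measure \<mu> ((B + 1) * K)"
    using assms(1) f(3) B K(1) by (auto simp: S2_measure_def S2_measure_axioms_def)
  then show ?thesis by (rule that)
qed

context S2_measure
begin

lemma space_eq: "space \<mu> = S2"
  using sets_eq_imp_space_eq[OF sets_eq] by simp

lemma borel_measurable_\<mu>:
  assumes "f \<in> borel_measurable borel"
  shows "f \<in> borel_measurable \<mu>"
proof -
  have "borel_measurable \<mu> = borel_measurable (restrict_space borel S2)"
    by (rule measurable_cong_sets) (simp_all only: sets_eq sets_unif_S2)
  then show ?thesis
    using measurable_restrict_space1[OF assms] by blast
qed

text \<open>
  The sum of \<open>2 powr (k * p) * (K * (2 * (1/2)^k)\<^sup>2)\<close> over \<open>k\<close>, one term for each dyadic cap. At \<open>z = x\<close> the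
  integrand \<open>norm (x - z) powr (- p)\<close> below has the value \<open>0\<close>, not \<open>\<infinity>\<close>.
\<close>

definition moment_bound :: "real \<Rightarrow> real" where
  "moment_bound p = 4 * K / (1 - 2 powr (p - 2))"

lemma moment_bound_pos:
  assumes "p < 2"
  shows "moment_bound p > 0"
proof -
  have "2 powr (p - 2) < 2 powr 0"
    using assms by (intro powr_less_mono) auto
  then show ?thesis
    unfolding moment_bound_def using K_pos by (intro divide_pos_pos) auto
qed

text \<open>A point at distance comparable to \<open>(1/2)^k\<close> lies in the cap
  \<open>A k\<close>, where the integrand is at most \<open>(2 powr p)^k\<close>. The caps have mass
  of order \<open>(1/4)^k\<close>, so the dyadic pieces are dominated by a geometric series of ratio
  \<open>q = 2 powr (p - 2)\<close>, which is below 1 exactly when \<open>p < 2\<close>.\<close>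

lemma nn_integral_moment:
  assumes x: "x \<in> S2" and p: "0 \<le> p" "p < 2"
  shows "(\<integral>\<^sup>+z. ennreal (norm (x - z) powr (- p)) \<partial>\<mu>) \<le> ennreal (moment_bound p)"
proof -
  define A where "A k = {z \<in> S2. norm (x - z) \<le> 2 * (1/2)^k}" for k :: nat
  have A: "A k \<in> sets \<mu>" for k
    unfolding A_def sets_eq by (rule cap_measurable)
  define q where "q = 2 powr (p - 2)"
  have q: "0 < q" "q < 1"
    using p powr_less_mono[of "p - 2" 0 2] by (auto simp: q_def)
  have pw: "ennreal (norm (x - z) powr (- p)) \<le>
      (\<Sum>k. ennreal ((2 powr p)^k) * indicator (A k) z)" if z: "z \<in> S2" for z
  proof (cases "x = z")
    case False
    define t where "t = norm (x - z)"
    define F :: "nat \<Rightarrow> ennreal" where "F k = ennreal ((2 powr p)^k) * indicator (A k) z" for k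
    have "t \<le> norm x + norm z" unfolding t_def by (rule norm_triangle_ineq4)
    then have t: "0 < t" "t \<le> 2"
      using False x z by (auto simp: S2_def t_def)
    obtain k where k: "(1/2)^k < t" "t \<le> 2 * (1/2)^k"
      using dyadic_scale[OF t] .
    have "t powr (-p) \<le> ((1/2)^k) powr (-p)"
      using k p t by (intro powr_mono2') auto
    also have "\<dots> = (2 powr p)^k"
    proof -
      have "(1/2::real)^k = 2 powr (- real k)"
        by (simp add: powr_minus powr_realpow power_one_over inverse_eq_divide)
      moreover have "(2 powr p)^k = 2 powr (p * real k)"
        by (simp add: powr_realpow[symmetric] powr_powr)
      ultimately show ?thesis
        by (simp add: powr_powr mult.commute)
    qed
    finally have "ennreal (t powr (-p)) \<le> ennreal ((2 powr p)^k) * indicator (A k) z"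
      using k(2) z by (simp add: A_def t_def ennreal_leI)
    also have "\<dots> = F k" by (simp add: F_def)
    also have "\<dots> \<le> (\<Sum>k. F k)"
      using sum_le_suminf[of F "{k}"] by simp
    finally show ?thesis by (simp add: t_def F_def)
  qed simp
  have "(\<integral>\<^sup>+z. ennreal (norm (x - z) powr (- p)) \<partial>\<mu>) \<le>
      (\<integral>\<^sup>+z. (\<Sum>k. ennreal ((2 powr p)^k) * indicator (A k) z) \<partial>\<mu>)"
    using pw by (intro nn_integral_mono) (simp add: space_eq)
  also have "\<dots> = (\<Sum>k. \<integral>\<^sup>+z. ennreal ((2 powr p)^k) * indicator (A k) z \<partial>\<mu>)"
    using A by (intro nn_integral_suminf) auto
  also have "\<dots> = (\<Sum>k. ennreal ((2 powr p)^k) * emeasure \<mu> (A k))"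
    using A by (simp add: nn_integral_cmult_indicator)
  also have "\<dots> \<le> (\<Sum>k. ennreal (4 * K * q^k))"
  proof (intro suminf_le summableI)
    fix k
    have "ennreal ((2 powr p)^k) * emeasure \<mu> (A k) \<le>
        ennreal ((2 powr p)^k) * ennreal (K * (2 * (1/2)^k)\<^sup>2)"
      unfolding A_def by (intro mult_left_mono cap_bound x) auto
    also have "\<dots> = ennreal ((2 powr p)^k * (K * (2 * (1/2)^k)\<^sup>2))"
      using K_pos by (intro ennreal_mult[symmetric]) auto
    also have "(2 * (1/2)^k)\<^sup>2 = (4::real) * (1/4)^k"
      by (simp add: power2_eq_square flip: power_mult_distrib)
    also have "(2 powr p)^k * (K * (4 * (1/4)^k)) = 4 * K * ((2 powr p)^k * (1/4)^k)"
      by simp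
    also have "(2 powr p)^k * (1/4)^k = q^k"
      by (simp add: q_def powr_diff power_divide)
    finally show "ennreal ((2 powr p)^k) * emeasure \<mu> (A k) \<le> ennreal (4 * K * q^k)" .
  qed
  also have "\<dots> = ennreal (4 * K * (1 / (1 - q)))"
    using q K_pos by (intro suminf_ennreal_eq sums_mult geometric_sums) auto
  finally show ?thesis by (simp add: moment_bound_def q_def)
qed

lemma measurable_norm_powr: "(\<lambda>z. norm (x - z) powr p) \<in> borel_measurable \<mu>"
proof (rule borel_measurable_\<mu>)
  have "(\<lambda>z. norm (x - z)) \<in> borel_measurable borel"
    by (intro borel_measurable_continuous_onI continuous_intros)
  then show "(\<lambda>z. norm (x - z) powr p) \<in> borel_measurable borel"
    by (rule powr_real_measurable) simp
qed

lemma
  assumes x: "x \<in> S2" and p: "0 \<le> p" "p < 2"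
  shows integrable_moment: "integrable \<mu> (\<lambda>z. norm (x - z) powr (- p))"
    and integral_moment: "(\<integral>z. norm (x - z) powr (- p) \<partial>\<mu>) \<le> moment_bound p"
proof -
  show i: "integrable \<mu> (\<lambda>z. norm (x - z) powr (- p))"
  proof (rule integrableI_bounded)
    show "(\<integral>\<^sup>+z. ennreal (norm (norm (x - z) powr (- p))) \<partial>\<mu>) < \<infinity>"
      using le_less_trans[OF nn_integral_moment[OF assms] ennreal_less_top] by simp
  qed (rule measurable_norm_powr)
  have "ennreal (\<integral>z. norm (x - z) powr (- p) \<partial>\<mu>) \<le> ennreal (moment_bound p)"
    using nn_integral_moment[OF assms] by (simp add: nn_integral_eq_integral[OF i])
  then show "(\<integral>z. norm (x - z) powr (- p) \<partial>\<mu>) \<le> moment_bound p"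
    using moment_bound_pos[OF p(2)] by (simp add: ennreal_le_iff)
qed

end

section \<open>Continuity of the Cauchy transform\<close>

lemma wcoord_eq: "wcoord = (\<lambda>x. (of_real (x $ 1) + \<i> * of_real (x $ 2)) / of_real (1 - x $ 3))"
  by (simp add: wcoord_def Complex_eq fun_eq_iff)

lemma borel_measurable_wcoord [measurable]: "wcoord \<in> borel_measurable borel"
proof -
  have [measurable]: "(\<lambda>x::real^3. x $ i) \<in> borel_measurable borel" for i
    by (intro borel_measurable_continuous_onI continuous_intros)
  show ?thesis unfolding wcoord_eq by measurable
qed

text \<open>The logarithmic derivative of \<open>lin_factor\<close>. The value 0 at
  \<open>origin_pt\<close> belongs to the constant factor 1 there, and is also the limit as the zero
  moves to infinity. Division by zero makes the value 0 when \<open>\<zeta>\<close> has coordinate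
  \<open>w\<close>.\<close>

definition kern :: "complex \<Rightarrow> real^3 \<Rightarrow> complex" where
  "kern w \<zeta> = (if \<zeta> = origin_pt then 0 else 1 / (w - wcoord \<zeta>))"

lemma borel_measurable_kern [measurable]: "kern w \<in> borel_measurable borel"
  unfolding kern_def[abs_def] by measurable

text \<open>A negative power reverses the comparison in \<open>norm_le_wcoord\<close>. At
  \<open>x = \<zeta>\<close> both sides are 0, because \<open>0 powr y\<close> is 0.\<close>

lemma inverse_wcoord_diff_le:
  assumes "x \<in> S2 - {origin_pt}" "\<zeta> \<in> S2 - {origin_pt}" "0 \<le> p"
  shows "cmod (wcoord x - wcoord \<zeta>) powr (- p) \<le> 2 powr p * norm (x - \<zeta>) powr (- p)"
proof (cases "x = \<zeta>")
  case False
  then have n: "norm (x - \<zeta>) / 2 > 0" "norm (x - \<zeta>) / 2 \<le> cmod (wcoord x - wcoord \<zeta>)"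
    using norm_le_wcoord[OF assms(1,2)] by auto
  then have "cmod (wcoord x - wcoord \<zeta>) powr (- p) \<le> (norm (x - \<zeta>) / 2) powr (- p)"
    using assms(3) by (intro powr_mono2') auto
  also have "\<dots> = 2 powr p * norm (x - \<zeta>) powr (- p)"
    by (simp add: powr_divide powr_minus_divide field_simps)
  finally show ?thesis .
qed simp

lemma norm_kern_le:
  assumes "x \<in> S2 - {origin_pt}" "\<zeta> \<in> S2"
  shows "cmod (kern (wcoord x) \<zeta>) \<le> 2 * norm (x - \<zeta>) powr (- 1)"
  using inverse_wcoord_diff_le[OF assms(1), of \<zeta> 1] assms(2)
  by (auto simp: kern_def norm_divide powr_minus_divide)

text \<open>If \<open>b\<close> is the smaller in modulus, the difference is bounded both by
  \<open>2 / cmod b\<close> and by \<open>cmod (a - b) / (cmod b)\<^sup>2\<close>. The geometric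
  mean of the two trades half a power of \<open>cmod (a - b)\<close> for the exponent 3/2, whose
  moment is still finite. The cases where \<open>a\<close> or \<open>b\<close> vanishes obey the
  conventions for division and \<open>powr\<close> and are treated by \<open>zero\<close>.\<close>

lemma norm_diff_inverse_le:
  fixes a b :: complex
  shows "cmod (1 / a - 1 / b) \<le> sqrt (2 * cmod (a - b)) * (cmod a powr (- 3/2) + cmod b powr (- 3/2))"
proof -
  have le: "cmod (1 / a - 1 / b) \<le> sqrt (2 * cmod (a - b)) * cmod b powr (- 3/2)"
    if ab: "cmod b \<le> cmod a" "b \<noteq> 0" for a b :: complex
  proof -
    have pos: "cmod b > 0" "cmod a > 0" "a \<noteq> 0" using ab by auto
    have "cmod (1 / a - 1 / b) \<le> 1 / cmod a + 1 / cmod b"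
      using norm_triangle_ineq4[of "1 / a" "1 / b"] by (simp add: norm_divide)
    also have "\<dots> \<le> 2 / cmod b"
      using pos ab frac_le[of 1 1 "cmod b" "cmod a"] by simp
    finally have 1: "cmod (1 / a - 1 / b) \<le> 2 / cmod b" .
    have "1 / a - 1 / b = (b - a) / (a * b)"
      using pos(3) ab(2) by (simp add: field_simps)
    then have "cmod (1 / a - 1 / b) = cmod (a - b) / (cmod a * cmod b)"
      by (simp add: norm_divide norm_mult norm_minus_commute)
    also have "\<dots> \<le> cmod (a - b) / (cmod b * cmod b)"
      using pos ab(1) by (intro divide_left_mono mult_right_mono mult_pos_pos) auto
    finally have 2: "cmod (1 / a - 1 / b) \<le> cmod (a - b) / (cmod b * cmod b)" .
    have "(cmod (1 / a - 1 / b))\<^sup>2 \<le> 2 / cmod b * (cmod (a - b) / (cmod b * cmod b))"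
      unfolding power2_eq_square using 1 2 by (intro mult_mono) auto
    also have "\<dots> = 2 * cmod (a - b) * cmod b powr (- 3)"
      using pos by (simp add: powr_minus_divide powr_numeral power3_eq_cube)
    also have "\<dots> = (sqrt (2 * cmod (a - b)) * cmod b powr (- 3/2))\<^sup>2"
      using pos by (simp add: power_mult_distrib power2_eq_square[of "_ powr _"] flip: powr_add)
    finally show ?thesis
      by (rule power2_le_imp_le) simp
  qed
  have zero: "cmod (1 / b) \<le> sqrt (2 * cmod b) * cmod b powr (- 3/2)" for b :: complex
  proof (cases "b = 0")
    case False
    have "sqrt (2 * cmod b) * cmod b powr (- 3/2) = sqrt 2 * (cmod b powr (1/2) * cmod b powr (- 3/2))"
      by (simp add: real_sqrt_mult powr_half_sqrt)
    also have "cmod b powr (1/2) * cmod b powr (- 3/2) = cmod (1 / b)"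
    proof -
      have "cmod b powr (1/2) * cmod b powr (- 3/2) = cmod b powr (- 1)"
        by (simp flip: powr_add)
      then show ?thesis by (simp add: powr_minus_divide norm_divide)
    qed
    also have "1 * cmod (1 / b) \<le> sqrt 2 * cmod (1 / b)"
      by (intro mult_right_mono) auto
    finally show ?thesis by simp
  qed simp
  consider "a = 0" | "b = 0" | "a \<noteq> 0" "b \<noteq> 0" "cmod b \<le> cmod a" | "a \<noteq> 0" "b \<noteq> 0" "cmod a \<le> cmod b"
    by linarith
  then show ?thesis
  proof cases
    case 1 then show ?thesis using zero[of b] by (simp add: norm_divide)
  next
    case 2 then show ?thesis using zero[of a] by (simp add: norm_divide)
  next
    case 3 then show ?thesis using le[of b a] by (smt (verit) mult_left_mono powr_ge_zero real_sqrt_ge_zero norm_ge_zero)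
  next
    case 4 then show ?thesis using le[of a b]
      by (smt (verit) mult_left_mono powr_ge_zero real_sqrt_ge_zero norm_ge_zero norm_minus_commute)
  qed
qed

lemma norm_kern_diff_le:
  assumes x: "x \<in> S2 - {origin_pt}" and y: "y \<in> S2 - {origin_pt}" and \<zeta>: "\<zeta> \<in> S2"
  shows "cmod (kern (wcoord x) \<zeta> - kern (wcoord y) \<zeta>) \<le>
    sqrt (2 * cmod (wcoord x - wcoord y)) * 2 powr (3/2) * (norm (x - \<zeta>) powr (- 3/2) + norm (y - \<zeta>) powr (- 3/2))"
proof (cases "\<zeta> = origin_pt")
  case False
  then have "cmod (kern (wcoord x) \<zeta> - kern (wcoord y) \<zeta>) \<le> sqrt (2 * cmod (wcoord x - wcoord y)) *
      (cmod (wcoord x - wcoord \<zeta>) powr (- 3/2) + cmod (wcoord y - wcoord \<zeta>) powr (- 3/2))"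
    using norm_diff_inverse_le[of "wcoord x - wcoord \<zeta>" "wcoord y - wcoord \<zeta>"] by (simp add: kern_def)
  also have "\<dots> \<le> sqrt (2 * cmod (wcoord x - wcoord y)) *
      (2 powr (3/2) * norm (x - \<zeta>) powr (- 3/2) + 2 powr (3/2) * norm (y - \<zeta>) powr (- 3/2))"
    using inverse_wcoord_diff_le[OF x, of \<zeta> "3/2"] inverse_wcoord_diff_le[OF y, of \<zeta> "3/2"] False \<zeta>
    by (intro mult_left_mono add_mono) auto
  finally show ?thesis by (simp add: algebra_simps)
qed (simp add: kern_def)

context S2_measure
begin

lemma phi_eq: "phi \<mu> w = (\<integral>\<zeta>. kern w \<zeta> \<partial>\<mu>)"
  unfolding phi_def set_lebesgue_integral_def
  by (intro Bochner_Integration.integral_cong) (auto simp: kern_def space_eq indicator_def)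

lemma measurable_kern: "kern w \<in> borel_measurable \<mu>"
  by (intro borel_measurable_\<mu> borel_measurable_kern)

lemma integrable_kern:
  assumes x: "x \<in> S2 - {origin_pt}"
  shows "integrable \<mu> (kern (wcoord x))"
proof (rule Bochner_Integration.integrable_bound)
  show "integrable \<mu> (\<lambda>\<zeta>. 2 * norm (x - \<zeta>) powr (- 1))"
    using x by (intro integrable_mult_right integrable_moment) auto
  show "AE \<zeta> in \<mu>. cmod (kern (wcoord x) \<zeta>) \<le> norm (2 * norm (x - \<zeta>) powr (- 1))"
    using norm_kern_le[OF x] by (intro AE_I2) (simp add: space_eq)
qed (rule measurable_kern)

text \<open>Integrating the pointwise bound \<open>norm_kern_diff_le\<close> against the moment of
  order 3/2 gives Hoelder continuity of exponent 1/2 with respect to the coordinate.\<close>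

lemma norm_phi_diff_le:
  assumes x: "x \<in> S2 - {origin_pt}" and y: "y \<in> S2 - {origin_pt}"
  shows "cmod (phi \<mu> (wcoord x) - phi \<mu> (wcoord y)) \<le>
    sqrt (2 * cmod (wcoord x - wcoord y)) * 2 powr (3/2) * (2 * moment_bound (3/2))"
proof -
  let ?c = "sqrt (2 * cmod (wcoord x - wcoord y)) * 2 powr (3/2)"
  have m: "integrable \<mu> (\<lambda>\<zeta>. norm (z - \<zeta>) powr (- 3/2))"
    "(\<integral>\<zeta>. norm (z - \<zeta>) powr (- 3/2) \<partial>\<mu>) \<le> moment_bound (3/2)" if "z \<in> S2" for z
    using integrable_moment[OF that, of "3/2"] integral_moment[OF that, of "3/2"] by auto
  have ix: "x \<in> S2" "y \<in> S2" using x y by auto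
  have "phi \<mu> (wcoord x) - phi \<mu> (wcoord y) = (\<integral>\<zeta>. kern (wcoord x) \<zeta> - kern (wcoord y) \<zeta> \<partial>\<mu>)"
    unfolding phi_eq by (intro Bochner_Integration.integral_diff[symmetric] integrable_kern x y)
  also have "cmod \<dots> \<le> (\<integral>\<zeta>. cmod (kern (wcoord x) \<zeta> - kern (wcoord y) \<zeta>) \<partial>\<mu>)"
    by (rule integral_norm_bound)
  also have "\<dots> \<le> (\<integral>\<zeta>. ?c * (norm (x - \<zeta>) powr (- 3/2) + norm (y - \<zeta>) powr (- 3/2)) \<partial>\<mu>)"
    using norm_kern_diff_le[OF x y]
    by (intro integral_mono integrable_norm Bochner_Integration.integrable_diff integrable_kern x y
        integrable_mult_right Bochner_Integration.integrable_add m ix) (simp add: space_eq)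
  also have "\<dots> = ?c * ((\<integral>\<zeta>. norm (x - \<zeta>) powr (- 3/2) \<partial>\<mu>) + (\<integral>\<zeta>. norm (y - \<zeta>) powr (- 3/2) \<partial>\<mu>))"
    using m ix by simp
  also have "\<dots> \<le> ?c * (2 * moment_bound (3/2))"
    using m(2)[OF ix(1)] m(2)[OF ix(2)] by (intro mult_left_mono) auto
  finally show ?thesis .
qed

end

section \<open>The fixed point equation\<close>

text \<open>The bound on \<open>e\<close> keeps \<open>cmod (A w)\<close> at least
  \<open>cmod a / 2\<close>. Then \<open>R\<close> is large enough for the map \<open>T\<close> to
  preserve the disk, the bound on \<open>L\<close> makes \<open>T\<close> a contraction of ratio
  1/2, and Banach's theorem applies.\<close>

lemma perturbed_critical_point:
  fixes A :: "complex \<Rightarrow> complex" and x0 a :: complex and N R e L :: real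
  assumes a: "a \<noteq> 0" and N: "N > 0" and R: "2 / cmod a \<le> R"
    and close: "\<And>w. w \<in> cball x0 (R / N) \<Longrightarrow> cmod (A w - a) \<le> e" and e: "e \<le> cmod a / 2"
    and Lip: "\<And>w v. w \<in> cball x0 (R / N) \<Longrightarrow> v \<in> cball x0 (R / N) \<Longrightarrow>
      cmod (A w - A v) \<le> N * L * cmod (w - v)"
    and L: "0 \<le> L" "8 * L \<le> (cmod a)\<^sup>2"
  obtains w where "w \<in> cball x0 (R / N)" "1 + of_real N * (w - x0) * A w = 0"
    "\<And>v. v \<in> cball x0 (R / N) \<Longrightarrow> 1 + of_real N * (v - x0) * A v = 0 \<Longrightarrow> v = w"
    "cmod (w - (x0 - 1 / (of_real N * a))) \<le> 4 * e / ((cmod a)\<^sup>2 * N)"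
proof -
  let ?B = "cball x0 (R / N)"
  define T where "T w = x0 - 1 / (of_real N * A w)" for w
  have a0: "cmod a > 0" using a by simp
  have R0: "R > 0" using R a0 by (smt (verit) divide_pos_pos)
  have A_ge: "cmod (A w) \<ge> cmod a / 2" if "w \<in> ?B" for w
    using close[OF that] e norm_triangle_ineq2[of a "a - A w"] by (simp add: norm_minus_commute)
  then have A_nz: "A w \<noteq> 0" if "w \<in> ?B" for w
    using that a0 by fastforce
  have fix_iff: "1 + of_real N * (w - x0) * A w = 0 \<longleftrightarrow> T w = w" if "w \<in> ?B" for w
    using A_nz[OF that] N by (auto simp: T_def field_simps add_eq_0_iff)
  have T_in: "T w \<in> ?B" if "w \<in> ?B" for w
  proof -
    have "cmod (x0 - T w) = 1 / (N * cmod (A w))"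
      using N by (simp add: T_def norm_divide norm_mult)
    also have "\<dots> \<le> 1 / (N * (cmod a / 2))"
      using A_ge[OF that] a0 N by (intro divide_left_mono mult_left_mono mult_pos_pos) auto
    also have "\<dots> = (2 / cmod a) / N" by simp
    also have "\<dots> \<le> R / N" using R N by (intro divide_right_mono) auto
    finally show ?thesis by (simp add: dist_norm)
  qed
  \<comment> \<open>This estimate serves twice: with \<open>b = A v\<close> it gives the
    contraction, and with \<open>b = a\<close> the location of the fixed point.\<close>
  have T_diff: "cmod (T w - (x0 - 1 / (of_real N * b))) \<le> 4 * cmod (A w - b) / ((cmod a)\<^sup>2 * N)"
    if w: "w \<in> ?B" and b: "cmod b \<ge> cmod a / 2" for w b
  proof -
    have nz: "A w \<noteq> 0" "b \<noteq> 0" using A_nz[OF w] b a0 by auto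
    have "T w - (x0 - 1 / (of_real N * b)) = (A w - b) / (of_real N * (A w * b))"
      using nz N by (simp add: T_def field_simps)
    then have "cmod (T w - (x0 - 1 / (of_real N * b))) = cmod (A w - b) / (N * (cmod (A w) * cmod b))"
      using N by (simp add: norm_divide norm_mult)
    also have "\<dots> \<le> cmod (A w - b) / (N * ((cmod a / 2) * (cmod a / 2)))"
      using A_ge[OF w] b a0 N by (intro divide_left_mono mult_left_mono mult_mono mult_pos_pos) auto
    also have "\<dots> = 4 * cmod (A w - b) / ((cmod a)\<^sup>2 * N)"
      by (simp add: power2_eq_square mult_ac)
    finally show ?thesis .
  qed
  have contr: "dist (T w) (T v) \<le> (1 / 2) * dist w v" if w: "w \<in> ?B" and v: "v \<in> ?B" for w v
  proof -
    have "dist (T w) (T v) \<le> 4 * cmod (A w - A v) / ((cmod a)\<^sup>2 * N)"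
      using T_diff[OF w A_ge[OF v]] by (simp add: T_def dist_norm)
    also have "\<dots> \<le> 4 * (N * L * cmod (w - v)) / ((cmod a)\<^sup>2 * N)"
      using Lip[OF w v] a0 N by (intro divide_right_mono) auto
    also have "\<dots> = (4 * L / (cmod a)\<^sup>2) * dist w v"
      using N by (simp add: dist_norm)
    also have "4 * L / (cmod a)\<^sup>2 \<le> 1 / 2"
      using L a0 by (simp add: field_simps)
    finally show ?thesis by (simp add: mult_right_mono)
  qed
  have "0 \<le> R / N" using R0 N by simp
  then have "\<exists>!w\<in>?B. T w = w"
    using T_in contr by (intro Banach_fix[where c = "1/2"] compact_imp_complete[OF compact_cball]) auto
  then obtain w where w: "w \<in> ?B" "T w = w" and u: "\<And>v. v \<in> ?B \<Longrightarrow> T v = v \<Longrightarrow> v = w"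
    by blast
  have D: "cmod (w - (x0 - 1 / (of_real N * a))) \<le> 4 * e / ((cmod a)\<^sup>2 * N)"
  proof -
    have "cmod (T w - (x0 - 1 / (of_real N * a))) \<le> 4 * cmod (A w - a) / ((cmod a)\<^sup>2 * N)"
      using T_diff[OF w(1), of a] a0 by simp
    also have "\<dots> \<le> 4 * e / ((cmod a)\<^sup>2 * N)"
      using close[OF w(1)] a0 N by (intro divide_right_mono) auto
    finally show ?thesis by (simp add: w)
  qed
  show ?thesis
    using w u fix_iff D that by blast
qed

section \<open>Differentiating the random polynomial\<close>

lemma logarithmic_derivative_mult:
  assumes "(f has_field_derivative f x * l) (at x)" "(g has_field_derivative g x * m) (at x)"
  shows "((\<lambda>w. f w * g w) has_field_derivative f x * g x * (l + m)) (at x)"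
  using DERIV_mult[OF assms] by (simp add: algebra_simps)

text \<open>No logarithmic derivative of the factor \<open>w - b\<close> is formed, so the formula
  remains valid at its zero \<open>x = b\<close>.\<close>

lemma derivative_mult_linear:
  fixes f :: "'a::real_normed_field \<Rightarrow> 'a"
  assumes "(f has_field_derivative f x * l) (at x)"
  shows "((\<lambda>w. f w * (w - b)) has_field_derivative f x * (1 + (x - b) * l)) (at x)"
proof -
  have "((\<lambda>w. w - b) has_field_derivative 1) (at x)"
    by (auto intro!: derivative_eq_intros)
  from DERIV_mult[OF assms this] show ?thesis
    by (simp add: algebra_simps)
qed

lemma logarithmic_derivative_prod:
  assumes "\<And>j. j \<in> I \<Longrightarrow> (f j has_field_derivative f j x * l j) (at x)"
  shows "((\<lambda>w. \<Prod>j\<in>I. f j w) has_field_derivative (\<Prod>j\<in>I. f j x) * (\<Sum>j\<in>I. l j)) (at x)"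
  using assms
proof (induction I rule: infinite_finite_induct)
  case (insert i I)
  then show ?case
    using logarithmic_derivative_mult[of "f i" x "l i" "\<lambda>w. \<Prod>j\<in>I. f j w" "\<Sum>j\<in>I. l j"] by simp
qed auto

lemma lin_factor_deriv:
  assumes "lin_factor \<zeta> w \<noteq> 0"
  shows "(lin_factor \<zeta> has_field_derivative lin_factor \<zeta> w * kern w \<zeta>) (at w)"
proof (cases "\<zeta> = origin_pt")
  case True
  then show ?thesis by (simp add: lin_factor_def[abs_def] kern_def)
next
  case False
  then show ?thesis
    using assms by (auto simp: lin_factor_def[abs_def] kern_def intro!: derivative_eq_intros)
qed

text \<open>All factors except the one vanishing at \<open>\<xi>\<close> are treated
  logarithmically; that one is multiplied in last. The formula therefore covers
  \<open>w = wcoord \<xi>\<close> as well, and the critical points near \<open>\<xi>\<close> are the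
  zeros of the last bracket.\<close>

lemma deriv_rpoly:
  assumes w: "w \<noteq> 0" and \<xi>: "\<xi> \<noteq> origin_pt"
    and nz: "\<And>j. j \<in> {1..N-1} \<Longrightarrow> lin_factor (zs j) w \<noteq> 0"
  shows "deriv (rpoly N \<xi> zs) w = 1 / w ^ N * (\<Prod>j=1..N-1. lin_factor (zs j) w) *
    (1 + (w - wcoord \<xi>) * (- of_nat N / w + (\<Sum>j=1..N-1. kern w (zs j))))"
proof -
  have "((\<lambda>w. \<Prod>j\<in>{1..N}. 1 / w) has_field_derivative (\<Prod>j\<in>{1..N}. 1 / w) * (\<Sum>j\<in>{1..N}. - 1 / w)) (at w)"
    by (rule logarithmic_derivative_prod)
      (use w in \<open>auto intro!: derivative_eq_intros simp: field_simps power2_eq_square\<close>)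
  then have 1: "((\<lambda>w. 1 / w ^ N) has_field_derivative 1 / w ^ N * (- of_nat N / w)) (at w)"
    by (simp add: power_one_over)
  have "((\<lambda>w. 1 / w ^ N * (\<Prod>j=1..N-1. lin_factor (zs j) w)) has_field_derivative
      1 / w ^ N * (\<Prod>j=1..N-1. lin_factor (zs j) w) * (- of_nat N / w + (\<Sum>j=1..N-1. kern w (zs j)))) (at w)"
    by (intro logarithmic_derivative_mult 1 logarithmic_derivative_prod lin_factor_deriv nz)
  then have "((\<lambda>w. 1 / w ^ N * (\<Prod>j=1..N-1. lin_factor (zs j) w) * (w - wcoord \<xi>)) has_field_derivative
      1 / w ^ N * (\<Prod>j=1..N-1. lin_factor (zs j) w) *
        (1 + (w - wcoord \<xi>) * (- of_nat N / w + (\<Sum>j=1..N-1. kern w (zs j))))) (at w)"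
    by (rule derivative_mult_linear)
  moreover have "rpoly N \<xi> zs = (\<lambda>w. 1 / w ^ N * (\<Prod>j=1..N-1. lin_factor (zs j) w) * (w - wcoord \<xi>))"
    using \<xi> by (simp add: rpoly_def[abs_def] lin_factor_def[of \<xi>] fun_eq_iff)
  ultimately show ?thesis
    by (simp add: DERIV_imp_deriv)
qed

text \<open>Both \<open>w\<close> and \<open>v\<close> have modulus at least
  \<open>cmod x / 2\<close>, which bounds the denominator of
  \<open>(v - w) / (w * v)\<close>.\<close>

lemma norm_inverse_diff_le:
  fixes w v x :: complex
  assumes x: "x \<noteq> 0" and w: "cmod (w - x) \<le> cmod x / 2" and v: "cmod (v - x) \<le> cmod x / 2"
  shows "cmod (1 / w - 1 / v) \<le> 4 / (cmod x)\<^sup>2 * cmod (w - v)" "w \<noteq> 0" "v \<noteq> 0"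
proof -
  have x0: "cmod x > 0" using x by simp
  have ge: "cmod w \<ge> cmod x / 2" "cmod v \<ge> cmod x / 2"
    using w v norm_triangle_ineq2[of x "x - w"] norm_triangle_ineq2[of x "x - v"]
    by (simp_all add: norm_minus_commute)
  then show nz: "w \<noteq> 0" "v \<noteq> 0" using x0 by fastforce+
  have "1 / w - 1 / v = (v - w) / (w * v)" using nz by (simp add: field_simps)
  then have "cmod (1 / w - 1 / v) = cmod (w - v) / (cmod w * cmod v)"
    by (simp add: norm_divide norm_mult norm_minus_commute)
  also have "\<dots> \<le> cmod (w - v) / ((cmod x / 2) * (cmod x / 2))"
    using x0 ge by (intro divide_left_mono mult_mono mult_pos_pos) auto
  also have "\<dots> = 4 / (cmod x)\<^sup>2 * cmod (w - v)"
    by (simp add: power2_eq_square)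
  finally show "cmod (1 / w - 1 / v) \<le> 4 / (cmod x)\<^sup>2 * cmod (w - v)" .
qed

text \<open>The coordinate distance \<open>d\<close> from \<open>\<xi>\<close> to
  \<open>\<zeta>\<close> has modulus at least half the chord, hence more than \<open>2 * t\<close>.
  So every point of the disk stays at least \<open>cmod d / 2\<close> from the coordinate of
  \<open>\<zeta>\<close>, and \<open>norm_inverse_diff_le\<close> applies to the
  differences.\<close>

lemma kern_Lipschitz:
  assumes \<xi>: "\<xi> \<in> S2 - {origin_pt}" and \<zeta>: "\<zeta> \<in> S2" and t: "4 * t < norm (\<xi> - \<zeta>)"
    and w: "w \<in> cball (wcoord \<xi>) t" and v: "v \<in> cball (wcoord \<xi>) t"
  shows "cmod (kern w \<zeta> - kern v \<zeta>) \<le> 16 * norm (\<xi> - \<zeta>) powr (- 2) * cmod (w - v)"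
    and "lin_factor \<zeta> w \<noteq> 0"
proof -
  have "cmod (kern w \<zeta> - kern v \<zeta>) \<le> 16 * norm (\<xi> - \<zeta>) powr (- 2) * cmod (w - v)
      \<and> lin_factor \<zeta> w \<noteq> 0"
  proof (cases "\<zeta> = origin_pt")
    case False
    then have \<zeta>': "\<zeta> \<in> S2 - {origin_pt}" using \<zeta> by simp
    define d where "d = wcoord \<xi> - wcoord \<zeta>"
    have t0: "t \<ge> 0" using w by (metis centre_in_cball cball_eq_empty empty_iff not_le)
    have n: "norm (\<xi> - \<zeta>) > 0" using t t0 by linarith
    have d: "norm (\<xi> - \<zeta>) \<le> 2 * cmod d"
      unfolding d_def by (rule norm_le_wcoord[OF \<xi> \<zeta>'])
    then have td: "t \<le> cmod d / 2" "d \<noteq> 0" using t n by auto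
    have wd: "cmod (u - wcoord \<zeta> - d) \<le> cmod d / 2" if "u \<in> cball (wcoord \<xi>) t" for u
      using that td(1) by (simp add: d_def dist_norm norm_minus_commute)
    note * = norm_inverse_diff_le[OF td(2) wd[OF w] wd[OF v]]
    have "4 / (cmod d)\<^sup>2 \<le> 4 / (norm (\<xi> - \<zeta>) / 2)\<^sup>2"
      using d n by (intro divide_left_mono power_mono mult_pos_pos zero_less_power) auto
    also have "\<dots> = 16 * norm (\<xi> - \<zeta>) powr (- 2)"
      using n by (simp add: powr_minus_divide powr_numeral power_divide)
    finally have "4 / (cmod d)\<^sup>2 * cmod (w - v) \<le> 16 * norm (\<xi> - \<zeta>) powr (- 2) * cmod (w - v)"
      by (intro mult_right_mono) auto
    with * False show ?thesis
      by (simp add: kern_def lin_factor_def)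
  qed (simp add: kern_def lin_factor_def)
  then show "cmod (kern w \<zeta> - kern v \<zeta>) \<le> 16 * norm (\<xi> - \<zeta>) powr (- 2) * cmod (w - v)"
    "lin_factor \<zeta> w \<noteq> 0" by auto
qed

text \<open>The deterministic half of the argument. In \<open>L\<close>, the first term is the
  Lipschitz contribution of \<open>- 1 / w\<close> and the second that of the random zeros, both
  divided by \<open>N\<close>. The closeness \<open>L * R + \<eta>\<close> adds the variation of
  \<open>A\<close> over the disk to its error at the centre.\<close>

lemma unique_critical_coordinate:
  fixes N :: nat and R \<eta> :: real and \<xi> :: "real^3" and p :: complex
  defines "x0 \<equiv> wcoord \<xi>"
  defines "a \<equiv> - 1 / x0 + p"
  defines "L \<equiv> 4 / ((cmod x0)\<^sup>2 * N) + 16 * \<eta>"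
  assumes N: "N \<ge> 1" and \<xi>: "\<xi> \<in> S2 - {origin_pt}" and x0: "x0 \<noteq> 0" and a: "a \<noteq> 0"
    and R: "2 / cmod a \<le> R" and \<eta>: "\<eta> \<ge> 0"
    and far: "\<And>j. j \<in> {1..N-1} \<Longrightarrow> zs j \<in> S2 \<and> 4 * (R / N) < norm (\<xi> - zs j)"
    and near: "R / N \<le> cmod x0 / 2"
    and sq: "(\<Sum>j=1..N-1. norm (\<xi> - zs j) powr (- 2)) \<le> \<eta> * (real N)\<^sup>2"
    and lln: "cmod ((\<Sum>j=1..N-1. kern x0 (zs j)) / N - p) \<le> \<eta>"
    and e: "L * R + \<eta> \<le> cmod a / 2" and L: "8 * L \<le> (cmod a)\<^sup>2"
  shows "\<exists>w \<in> cball x0 (R / N). w \<noteq> 0 \<and> deriv (rpoly N \<xi> zs) w = 0 \<and>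
    (\<forall>v \<in> cball x0 (R / N). deriv (rpoly N \<xi> zs) v = 0 \<longrightarrow> v = w) \<and>
    cmod (w - (x0 - 1 / (of_nat N * a))) \<le> 4 * (L * R + \<eta>) / ((cmod a)\<^sup>2 * N)"
proof -
  let ?B = "cball x0 (R / N)"
  define A where "A w = - 1 / w + (\<Sum>j=1..N-1. kern w (zs j)) / N" for w
  have N0: "real N > 0" using N by simp
  have R0: "R > 0" using R a by (smt (verit) divide_pos_pos zero_less_norm_iff)
  have L0: "L \<ge> 0" using \<eta> by (simp add: L_def)
  have cen: "x0 \<in> ?B" using R0 by simp
  \<comment> \<open>The disk avoids \<open>w = 0\<close>, where \<open>- 1 / w\<close> has its
    pole.\<close>
  have near': "cmod (w - x0) \<le> cmod x0 / 2" if "w \<in> ?B" for w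
    using order_trans[OF _ near, of "cmod (w - x0)"] that by (simp add: dist_norm norm_minus_commute)
  have nz: "w \<noteq> 0" if "w \<in> ?B" for w
    using norm_inverse_diff_le(2)[OF x0 near'[OF that] near'[OF that]] .
  have lin: "lin_factor (zs j) w \<noteq> 0" if "w \<in> ?B" "j \<in> {1..N-1}" for w j
    using kern_Lipschitz(2)[OF \<xi>, of "zs j" "R / N" w w] far[OF that(2)] that(1) by (auto simp: x0_def)
  have crit: "deriv (rpoly N \<xi> zs) w = 0 \<longleftrightarrow> 1 + of_real (real N) * (w - x0) * A w = 0"
    if w: "w \<in> ?B" for w
  proof -
    have "deriv (rpoly N \<xi> zs) w = 1 / w ^ N * (\<Prod>j=1..N-1. lin_factor (zs j) w) *
        (1 + (w - x0) * (- of_nat N / w + (\<Sum>j=1..N-1. kern w (zs j))))"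
      using \<xi> unfolding x0_def by (intro deriv_rpoly nz[OF w] lin[OF w]) auto
    moreover have "- of_nat N / w + (\<Sum>j=1..N-1. kern w (zs j)) = of_real (real N) * A w"
      using N by (simp add: A_def field_simps)
    ultimately show ?thesis
      using nz[OF w] lin[OF w] by (simp add: mult_ac)
  qed
  have Lip: "cmod (A w - A v) \<le> N * L * cmod (w - v)" if w: "w \<in> ?B" and v: "v \<in> ?B" for w v
  proof -
    have "cmod ((\<Sum>j=1..N-1. kern w (zs j)) - (\<Sum>j=1..N-1. kern v (zs j)))
        \<le> (\<Sum>j=1..N-1. 16 * norm (\<xi> - zs j) powr (- 2) * cmod (w - v))"
      unfolding sum_subtractf[symmetric]
      by (intro sum_norm_le kern_Lipschitz(1)[OF \<xi>, where t = "R / N"])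
        (use far w v in \<open>auto simp: x0_def\<close>)
    also have "\<dots> = 16 * cmod (w - v) * (\<Sum>j=1..N-1. norm (\<xi> - zs j) powr (- 2))"
      by (simp add: sum_distrib_left mult_ac)
    also have "\<dots> \<le> 16 * cmod (w - v) * (\<eta> * (real N)\<^sup>2)"
      by (intro mult_left_mono sq) auto
    finally have s: "cmod ((\<Sum>j=1..N-1. kern w (zs j)) - (\<Sum>j=1..N-1. kern v (zs j))) / N
        \<le> 16 * cmod (w - v) * (\<eta> * (real N)\<^sup>2) / N"
      by (rule divide_right_mono) simp
    have "A w - A v = ((\<Sum>j=1..N-1. kern w (zs j)) - (\<Sum>j=1..N-1. kern v (zs j))) / N - (1 / w - 1 / v)"
      by (simp add: A_def diff_divide_distrib)
    then have "cmod (A w - A v) \<le>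
        cmod ((\<Sum>j=1..N-1. kern w (zs j)) - (\<Sum>j=1..N-1. kern v (zs j))) / N + cmod (1 / w - 1 / v)"
      using norm_triangle_ineq4 by (metis norm_divide norm_of_nat)
    also have "\<dots> \<le> 16 * cmod (w - v) * (\<eta> * (real N)\<^sup>2) / N + 4 / (cmod x0)\<^sup>2 * cmod (w - v)"
      by (intro add_mono s norm_inverse_diff_le(1)[OF x0 near'[OF w] near'[OF v]])
    also have "\<dots> = N * L * cmod (w - v)"
      using N0 x0 by (simp add: L_def field_simps power2_eq_square)
    finally show ?thesis .
  qed
  have close: "cmod (A w - a) \<le> L * R + \<eta>" if w: "w \<in> ?B" for w
  proof -
    have "cmod (A w - A x0) \<le> N * L * cmod (w - x0)" by (rule Lip[OF w cen])
    also have "\<dots> \<le> N * L * (R / N)"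
      using w L0 by (intro mult_left_mono) (auto simp: dist_norm norm_minus_commute)
    also have "\<dots> = L * R" using N0 by simp
    finally have "cmod (A w - A x0) \<le> L * R" .
    moreover have "cmod (A x0 - a) \<le> \<eta>" using lln by (simp add: A_def a_def)
    ultimately show ?thesis
      using norm_triangle_ineq[of "A w - A x0" "A x0 - a"] by simp
  qed
  obtain w where w: "w \<in> ?B" "1 + of_real (real N) * (w - x0) * A w = 0"
    "\<And>v. v \<in> ?B \<Longrightarrow> 1 + of_real (real N) * (v - x0) * A v = 0 \<Longrightarrow> v = w"
    "cmod (w - (x0 - 1 / (of_real (real N) * a))) \<le> 4 * (L * R + \<eta>) / ((cmod a)\<^sup>2 * N)"
    using perturbed_critical_point[OF a N0 R close e Lip L0 L] by blast
  show ?thesis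
  proof (intro bexI[OF _ w(1)] conjI nz[OF w(1)] ballI impI)
    show "deriv (rpoly N \<xi> zs) w = 0"
      unfolding crit[OF w(1)] by (rule w(2))
    show "v = w" if "v \<in> ?B" "deriv (rpoly N \<xi> zs) v = 0" for v
      using that(2) unfolding crit[OF that(1)] by (rule w(3)[OF that(1)])
    show "cmod (w - (x0 - 1 / (of_nat N * a))) \<le> 4 * (L * R + \<eta>) / ((cmod a)\<^sup>2 * N)"
      using w(4) by simp
  qed
qed

section \<open>Independent sums\<close>

context prob_space
begin

lemma prob_space_PiM_const: "prob_space (Pi\<^sub>M I (\<lambda>_. M))"
  by (intro prob_space_PiM prob_space_axioms)

lemma
  fixes f :: "'a \<Rightarrow> 'b::{banach, second_countable_topology}"
  assumes i: "i \<in> I" and f: "integrable M f"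
  shows integrable_PiM_component: "integrable (Pi\<^sub>M I (\<lambda>_. M)) (\<lambda>z. f (z i))"
    and integral_PiM_component: "(\<integral>z. f (z i) \<partial>Pi\<^sub>M I (\<lambda>_. M)) = (\<integral>x. f x \<partial>M)"
proof -
  have d: "distr (Pi\<^sub>M I (\<lambda>_. M)) M (\<lambda>z. z i) = M"
    using i by (intro distr_PiM_component prob_space_axioms)
  have m: "(\<lambda>z. z i) \<in> measurable (Pi\<^sub>M I (\<lambda>_. M)) M"
    using i by measurable
  show "integrable (Pi\<^sub>M I (\<lambda>_. M)) (\<lambda>z. f (z i))"
    using f by (intro integrable_distr[OF m]) (simp add: d)
  show "(\<integral>z. f (z i) \<partial>Pi\<^sub>M I (\<lambda>_. M)) = (\<integral>x. f x \<partial>M)"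
    using integral_distr[OF m, of f] f by (simp add: d borel_measurable_integrable)
qed

text \<open>The product of two coordinates is written as a product over the whole index set with
  factor 1 at the other indices, so that Fubini for finite products applies.\<close>

lemma
  fixes f :: "'a \<Rightarrow> real"
  assumes I: "finite I" "i \<in> I" "j \<in> I" "i \<noteq> j" and f: "integrable M f"
  shows integrable_PiM_cross: "integrable (Pi\<^sub>M I (\<lambda>_. M)) (\<lambda>z. f (z i) * f (z j))"
    and integral_PiM_cross: "(\<integral>z. f (z i) * f (z j) \<partial>Pi\<^sub>M I (\<lambda>_. M)) = (\<integral>x. f x \<partial>M)\<^sup>2"
proof -
  interpret P: product_sigma_finite "\<lambda>_. M"
    by unfold_locales
  define g where "g k x = (if k \<in> {i, j} then f x else 1)" for k x
  have sub: "{i, j} \<subseteq> I" using I by auto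
  have pr: "(\<Prod>k\<in>I. g k (z k)) = f (z i) * f (z j)" for z
  proof -
    have "(\<Prod>k\<in>I. g k (z k)) = (\<Prod>k\<in>{i, j}. g k (z k))"
      using I(1) sub by (intro prod.mono_neutral_right) (auto simp: g_def)
    then show ?thesis using I(4) by (simp add: g_def)
  qed
  have g1: "integral\<^sup>L M (g k) = 1" if "k \<notin> {i, j}" for k
  proof -
    have "g k = (\<lambda>_. 1)" using that by (auto simp: g_def)
    then show ?thesis by (simp add: prob_space)
  qed
  have pi: "(\<Prod>k\<in>I. integral\<^sup>L M (g k)) = (\<integral>x. f x \<partial>M)\<^sup>2"
  proof -
    have "(\<Prod>k\<in>I. integral\<^sup>L M (g k)) = (\<Prod>k\<in>{i, j}. integral\<^sup>L M (g k))"
      using I(1) sub by (intro prod.mono_neutral_right) (auto simp: g1)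
    moreover have "g i = f" "g j = f" by (auto simp: g_def)
    ultimately show ?thesis using I(4) by (simp add: power2_eq_square)
  qed
  have g: "integrable M (g k)" for k
    using f by (cases "k \<in> {i, j}") (auto simp: g_def[abs_def])
  show "integrable (Pi\<^sub>M I (\<lambda>_. M)) (\<lambda>z. f (z i) * f (z j))"
    using P.product_integrable_prod[where f = g, OF I(1) g] by (simp add: pr)
  show "(\<integral>z. f (z i) * f (z j) \<partial>Pi\<^sub>M I (\<lambda>_. M)) = (\<integral>x. f x \<partial>M)\<^sup>2"
    using P.product_integral_prod[where f = g, OF I(1) g] by (simp add: pr pi)
qed

text \<open>Expanding the square, the off-diagonal terms integrate to the squared mean, which is
  0.\<close>

lemma second_moment_sum_PiM:
  fixes f :: "'a \<Rightarrow> real"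
  assumes I: "finite I" and f: "integrable M f" "integrable M (\<lambda>x. (f x)\<^sup>2)" "(\<integral>x. f x \<partial>M) = 0"
  shows "integrable (Pi\<^sub>M I (\<lambda>_. M)) (\<lambda>z. (\<Sum>i\<in>I. f (z i))\<^sup>2)"
    and "(\<integral>z. (\<Sum>i\<in>I. f (z i))\<^sup>2 \<partial>Pi\<^sub>M I (\<lambda>_. M)) = card I * (\<integral>x. (f x)\<^sup>2 \<partial>M)"
proof -
  have eq: "(\<Sum>i\<in>I. f (z i))\<^sup>2 = (\<Sum>i\<in>I. \<Sum>j\<in>I. f (z i) * f (z j))" for z
    by (simp add: power2_eq_square sum_product)
  have int: "integrable (Pi\<^sub>M I (\<lambda>_. M)) (\<lambda>z. f (z i) * f (z j))" if "i \<in> I" "j \<in> I" for i j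
    using that integrable_PiM_cross[OF I that _ f(1)] integrable_PiM_component[OF that(1) f(2)]
    by (cases "i = j") (auto simp: power2_eq_square)
  have val: "(\<integral>z. f (z i) * f (z j) \<partial>Pi\<^sub>M I (\<lambda>_. M)) = (if i = j then (\<integral>x. (f x)\<^sup>2 \<partial>M) else 0)"
    if "i \<in> I" "j \<in> I" for i j
    using that integral_PiM_cross[OF I that _ f(1)] integral_PiM_component[OF that(1) f(2)] f(3)
    by (cases "i = j") (auto simp: power2_eq_square)
  show "integrable (Pi\<^sub>M I (\<lambda>_. M)) (\<lambda>z. (\<Sum>i\<in>I. f (z i))\<^sup>2)"
    unfolding eq by (intro Bochner_Integration.integrable_sum int)
  have "(\<integral>z. (\<Sum>i\<in>I. f (z i))\<^sup>2 \<partial>Pi\<^sub>M I (\<lambda>_. M)) =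
      (\<Sum>i\<in>I. \<Sum>j\<in>I. \<integral>z. f (z i) * f (z j) \<partial>Pi\<^sub>M I (\<lambda>_. M))"
    unfolding eq by (simp add: int)
  also have "\<dots> = (\<Sum>i\<in>I. \<Sum>j\<in>I. if i = j then (\<integral>x. (f x)\<^sup>2 \<partial>M) else 0)"
    by (intro sum.cong refl val)
  also have "\<dots> = card I * (\<integral>x. (f x)\<^sup>2 \<partial>M)"
    using I by simp
  finally show "(\<integral>z. (\<Sum>i\<in>I. f (z i))\<^sup>2 \<partial>Pi\<^sub>M I (\<lambda>_. M)) = card I * (\<integral>x. (f x)\<^sup>2 \<partial>M)" .
qed

text \<open>Chebyshev's inequality for the centred function \<open>h\<close>, with its variance
  estimated by the second moment of \<open>f\<close>.\<close>

lemma weak_law_PiM: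
  fixes f :: "'a \<Rightarrow> real"
  assumes I: "finite I" and f: "integrable M f" "integrable M (\<lambda>x. (f x)\<^sup>2)" and e: "e > 0"
  shows "measure (Pi\<^sub>M I (\<lambda>_. M)) {z \<in> space (Pi\<^sub>M I (\<lambda>_. M)). \<bar>(\<Sum>i\<in>I. f (z i)) - card I * (\<integral>x. f x \<partial>M)\<bar> \<ge> e}
    \<le> card I * (\<integral>x. (f x)\<^sup>2 \<partial>M) / e\<^sup>2"
proof -
  let ?P = "Pi\<^sub>M I (\<lambda>_. M)"
  define m where "m = (\<integral>x. f x \<partial>M)"
  define h where "h x = f x - m" for x
  have h2: "(h x)\<^sup>2 = (f x)\<^sup>2 - 2 * m * f x + m\<^sup>2" for x
    by (simp add: h_def power2_diff)
  have h: "integrable M h" "integrable M (\<lambda>x. (h x)\<^sup>2)" "(\<integral>x. h x \<partial>M) = 0"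
    using f unfolding h2 by (simp_all add: h_def[abs_def] m_def prob_space)
  have "(\<integral>x. (h x)\<^sup>2 \<partial>M) = (\<integral>x. (f x)\<^sup>2 \<partial>M) - m\<^sup>2"
    using f by (simp add: h2 prob_space) (simp add: m_def power2_eq_square)
  then have le: "(\<integral>x. (h x)\<^sup>2 \<partial>M) \<le> (\<integral>x. (f x)\<^sup>2 \<partial>M)" by simp
  have "measure ?P {z \<in> space ?P. (\<Sum>i\<in>I. h (z i))\<^sup>2 \<ge> e\<^sup>2} \<le>
      (\<integral>z. (\<Sum>i\<in>I. h (z i))\<^sup>2 \<partial>?P) / e\<^sup>2"
    using second_moment_sum_PiM(1)[OF I h] e
    by (intro integral_Markov_inequality_measure[where A = "{}"]) auto
  also have "\<dots> \<le> card I * (\<integral>x. (f x)\<^sup>2 \<partial>M) / e\<^sup>2"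
    unfolding second_moment_sum_PiM(2)[OF I h] using le by (intro divide_right_mono mult_left_mono) auto
  finally have *: "measure ?P {z \<in> space ?P. (\<Sum>i\<in>I. h (z i))\<^sup>2 \<ge> e\<^sup>2} \<le> card I * (\<integral>x. (f x)\<^sup>2 \<partial>M) / e\<^sup>2" .
  have "(e \<le> \<bar>(\<Sum>i\<in>I. f (z i)) - card I * m\<bar>) \<longleftrightarrow> (\<Sum>i\<in>I. h (z i))\<^sup>2 \<ge> e\<^sup>2" for z
    using e abs_le_square_iff[of e "\<Sum>i\<in>I. h (z i)"] by (simp add: h_def sum_subtractf)
  with * show ?thesis by (simp add: m_def)
qed

end

lemma (in prob_space) Markov_sum_PiM:
  fixes f :: "'a \<Rightarrow> real"
  assumes I: "finite I" and f: "integrable M f" "\<And>x. 0 \<le> f x" and e: "e > 0"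
  shows "measure (Pi\<^sub>M I (\<lambda>_. M)) {z \<in> space (Pi\<^sub>M I (\<lambda>_. M)). (\<Sum>i\<in>I. f (z i)) \<ge> e}
    \<le> card I * (\<integral>x. f x \<partial>M) / e"
proof -
  let ?P = "Pi\<^sub>M I (\<lambda>_. M)"
  have "measure ?P {z \<in> space ?P. (\<Sum>i\<in>I. f (z i)) \<ge> e} \<le> (\<integral>z. (\<Sum>i\<in>I. f (z i)) \<partial>?P) / e"
    using f e by (intro integral_Markov_inequality_measure[where A = "{}"] Bochner_Integration.integrable_sum
        integrable_PiM_component AE_I2 sum_nonneg) auto
  also have "(\<integral>z. (\<Sum>i\<in>I. f (z i)) \<partial>?P) = card I * (\<integral>x. f x \<partial>M)"
    using f by (simp add: integrable_PiM_component integral_PiM_component)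
  finally show ?thesis .
qed

lemma (in prob_space) union_bound_PiM:
  assumes I: "finite I" and A: "A \<in> sets M"
  shows "{z \<in> space (Pi\<^sub>M I (\<lambda>_. M)). \<exists>i\<in>I. z i \<in> A} \<in> sets (Pi\<^sub>M I (\<lambda>_. M))"
    and "measure (Pi\<^sub>M I (\<lambda>_. M)) {z \<in> space (Pi\<^sub>M I (\<lambda>_. M)). \<exists>i\<in>I. z i \<in> A} \<le> card I * measure M A"
proof -
  let ?P = "Pi\<^sub>M I (\<lambda>_. M)"
  interpret P: prob_space ?P by (rule prob_space_PiM_const)
  have S: "{z \<in> space ?P. z i \<in> A} \<in> sets ?P" if "i \<in> I" for i
    using that A by measurable
  have m: "measure ?P {z \<in> space ?P. z i \<in> A} = measure M A" if i: "i \<in> I" for i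
  proof -
    have mi: "(\<lambda>z. z i) \<in> measurable ?P M" using i by measurable
    have "measure (distr ?P M (\<lambda>z. z i)) A = measure ?P ((\<lambda>z. z i) -` A \<inter> space ?P)"
      by (rule measure_distr[OF mi A])
    moreover have "distr ?P M (\<lambda>z. z i) = M"
      using i by (intro distr_PiM_component prob_space_axioms)
    moreover have "(\<lambda>z. z i) -` A \<inter> space ?P = {z \<in> space ?P. z i \<in> A}" by auto
    ultimately show ?thesis by simp
  qed
  have eq: "{z \<in> space ?P. \<exists>i\<in>I. z i \<in> A} = (\<Union>i\<in>I. {z \<in> space ?P. z i \<in> A})" by auto
  show "{z \<in> space ?P. \<exists>i\<in>I. z i \<in> A} \<in> sets ?P"
    unfolding eq using I S by (intro sets.finite_UN) auto
  have "measure ?P {z \<in> space ?P. \<exists>i\<in>I. z i \<in> A} \<le> (\<Sum>i\<in>I. measure ?P {z \<in> space ?P. z i \<in> A})"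
    unfolding eq using I S by (intro P.finite_measure_subadditive_finite) auto
  also have "\<dots> = card I * measure M A" by (simp add: m)
  finally show "measure ?P {z \<in> space ?P. \<exists>i\<in>I. z i \<in> A} \<le> card I * measure M A" .
qed

section \<open>Truncated moments and the exceptional events\<close>

context S2_measure
begin

text \<open>The moment of order -2 is critical. Outside the cap, the factor
  \<open>norm (x - \<zeta>) powr (\<delta> - 1)\<close> is at most
  \<open>t powr (\<delta> - 1)\<close>, and what remains is the convergent moment of order
  \<open>- (1 + \<delta>)\<close>.\<close>

lemma truncated_second_moment:
  assumes x: "x \<in> S2" and t: "t > 0" and \<delta>: "0 < \<delta>" "\<delta> < 1"
  defines "q \<equiv> \<lambda>\<zeta>. if norm (x - \<zeta>) \<le> t then 0 else norm (x - \<zeta>) powr (- 2)"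
  shows "integrable \<mu> q" "(\<integral>\<zeta>. q \<zeta> \<partial>\<mu>) \<le> t powr (\<delta> - 1) * moment_bound (1 + \<delta>)"
proof -
  have le: "q \<zeta> \<le> t powr (\<delta> - 1) * norm (x - \<zeta>) powr (- (1 + \<delta>))" for \<zeta>
  proof (cases "norm (x - \<zeta>) \<le> t")
    case False
    then have n: "norm (x - \<zeta>) > t" "norm (x - \<zeta>) > 0" using t by auto
    have "norm (x - \<zeta>) powr (- 2) = norm (x - \<zeta>) powr (\<delta> - 1) * norm (x - \<zeta>) powr (- (1 + \<delta>))"
      by (simp flip: powr_add)
    also have "\<dots> \<le> t powr (\<delta> - 1) * norm (x - \<zeta>) powr (- (1 + \<delta>))"
      using n t \<delta> by (intro mult_right_mono powr_mono2') auto
    finally show ?thesis using False by (simp add: q_def)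
  qed (use t in \<open>simp add: q_def\<close>)
  have p: "0 \<le> 1 + \<delta>" "1 + \<delta> < 2" using \<delta> by auto
  have i: "integrable \<mu> (\<lambda>\<zeta>. t powr (\<delta> - 1) * norm (x - \<zeta>) powr (- (1 + \<delta>)))"
    by (intro integrable_mult_right integrable_moment x p)
  have q0: "q \<zeta> \<ge> 0" for \<zeta> by (simp add: q_def)
  have m: "q \<in> borel_measurable \<mu>"
  proof (rule borel_measurable_\<mu>)
    have [measurable]: "(\<lambda>\<zeta>. norm (x - \<zeta>)) \<in> borel_measurable borel"
      by (intro borel_measurable_continuous_onI continuous_intros)
    show "q \<in> borel_measurable borel" unfolding q_def by measurable
  qed
  show iq: "integrable \<mu> q"
    using i m by (rule Bochner_Integration.integrable_bound) (use le q0 in \<open>auto intro!: AE_I2 order_trans[OF le]\<close>)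
  have "(\<integral>\<zeta>. q \<zeta> \<partial>\<mu>) \<le> (\<integral>\<zeta>. t powr (\<delta> - 1) * norm (x - \<zeta>) powr (- (1 + \<delta>)) \<partial>\<mu>)"
    using iq i le by (rule integral_mono)
  also have "\<dots> = t powr (\<delta> - 1) * (\<integral>\<zeta>. norm (x - \<zeta>) powr (- (1 + \<delta>)) \<partial>\<mu>)"
    by simp
  also have "\<dots> \<le> t powr (\<delta> - 1) * moment_bound (1 + \<delta>)"
    by (intro mult_left_mono integral_moment x p) auto
  finally show "(\<integral>\<zeta>. q \<zeta> \<partial>\<mu>) \<le> t powr (\<delta> - 1) * moment_bound (1 + \<delta>)" .
qed

text \<open>The square of \<open>kern\<close> is controlled only by the critical power -2 of the
  distance. Cutting off the cap of radius \<open>t\<close> supplies the finite second moment that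
  Chebyshev's inequality asks for.\<close>

definition trunc_kern :: "real^3 \<Rightarrow> real \<Rightarrow> real^3 \<Rightarrow> complex" where
  "trunc_kern x t \<zeta> = (if norm (x - \<zeta>) \<le> t then 0 else kern (wcoord x) \<zeta>)"

lemma measurable_trunc_kern: "trunc_kern x t \<in> borel_measurable \<mu>"
proof (rule borel_measurable_\<mu>)
  have [measurable]: "(\<lambda>\<zeta>. norm (x - \<zeta>)) \<in> borel_measurable borel"
    by (intro borel_measurable_continuous_onI continuous_intros)
  show "trunc_kern x t \<in> borel_measurable borel" unfolding trunc_kern_def[abs_def] by measurable
qed

lemma integrable_trunc_kern:
  assumes "x \<in> S2 - {origin_pt}"
  shows "integrable \<mu> (trunc_kern x t)"
  using integrable_kern[OF assms] measurable_trunc_kern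
  by (rule Bochner_Integration.integrable_bound) (auto simp: trunc_kern_def)

text \<open>The bias comes from the removed cap, where
  \<open>norm (x - \<zeta>) powr \<delta>\<close> is at most \<open>t powr \<delta>\<close> and can
  be split off from the power -1.\<close>

lemma integral_trunc_kern:
  assumes x: "x \<in> S2 - {origin_pt}" and t: "t > 0" and \<delta>: "0 < \<delta>" "\<delta> < 1"
  shows "cmod ((\<integral>\<zeta>. trunc_kern x t \<zeta> \<partial>\<mu>) - phi \<mu> (wcoord x)) \<le> 2 * t powr \<delta> * moment_bound (1 + \<delta>)"
proof -
  have p: "0 \<le> 1 + \<delta>" "1 + \<delta> < 2" using \<delta> by auto
  have x': "x \<in> S2" using x by simp
  have le: "cmod (trunc_kern x t \<zeta> - kern (wcoord x) \<zeta>) \<le> 2 * t powr \<delta> * norm (x - \<zeta>) powr (- (1 + \<delta>))"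
    if \<zeta>: "\<zeta> \<in> S2" for \<zeta>
  proof (cases "norm (x - \<zeta>) \<le> t")
    case True
    have "cmod (kern (wcoord x) \<zeta>) \<le> 2 * norm (x - \<zeta>) powr (- 1)"
      by (rule norm_kern_le[OF x \<zeta>])
    also have "norm (x - \<zeta>) powr (- 1) = norm (x - \<zeta>) powr \<delta> * norm (x - \<zeta>) powr (- (1 + \<delta>))"
      by (simp flip: powr_add)
    also have "\<dots> \<le> t powr \<delta> * norm (x - \<zeta>) powr (- (1 + \<delta>))"
      using True \<delta> by (intro mult_right_mono powr_mono2) auto
    finally show ?thesis using True by (simp add: trunc_kern_def)
  qed (simp add: trunc_kern_def)
  have "(\<integral>\<zeta>. trunc_kern x t \<zeta> \<partial>\<mu>) - phi \<mu> (wcoord x) = (\<integral>\<zeta>. trunc_kern x t \<zeta> - kern (wcoord x) \<zeta> \<partial>\<mu>)"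
    unfolding phi_eq
    by (intro Bochner_Integration.integral_diff[symmetric] integrable_kern integrable_trunc_kern x)
  also have "cmod \<dots> \<le> (\<integral>\<zeta>. cmod (trunc_kern x t \<zeta> - kern (wcoord x) \<zeta>) \<partial>\<mu>)"
    by (rule integral_norm_bound)
  also have "\<dots> \<le> (\<integral>\<zeta>. 2 * t powr \<delta> * norm (x - \<zeta>) powr (- (1 + \<delta>)) \<partial>\<mu>)"
    using le by (intro integral_mono integrable_norm Bochner_Integration.integrable_diff integrable_kern
        integrable_trunc_kern x integrable_mult_right integrable_moment x' p) (simp add: space_eq)
  also have "\<dots> = 2 * t powr \<delta> * (\<integral>\<zeta>. norm (x - \<zeta>) powr (- (1 + \<delta>)) \<partial>\<mu>)"
    by simp
  also have "\<dots> \<le> 2 * t powr \<delta> * moment_bound (1 + \<delta>)"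
    by (intro mult_left_mono integral_moment x' p) auto
  finally show ?thesis .
qed

text \<open>The bad set \<open>B\<close> collects a random zero too close to \<open>x\<close>, a
  large truncated moment, and a large deviation of the real or imaginary part of the truncated
  kernel sum. Off the first event the truncation at \<open>c / N\<close> changes none of the sums,
  so the bounds hold for the untruncated ones.\<close>

lemma good_configurations:
  fixes c \<eta> \<delta> :: real
  assumes x: "x \<in> S2 - {origin_pt}" and c: "c > 0" and \<eta>: "\<eta> > 0" and \<delta>: "0 < \<delta>" "\<delta> < 1"
  shows "\<exists>C. \<forall>N\<ge>(1::nat). \<exists>B \<in> sets (Pi\<^sub>M {1..N-(1::nat)} (\<lambda>_. \<mu>)).
     measure (Pi\<^sub>M {1..N-(1::nat)} (\<lambda>_. \<mu>)) B \<le> C * N powr (- \<delta>) \<and>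
     (\<forall>z \<in> space (Pi\<^sub>M {1..N-(1::nat)} (\<lambda>_. \<mu>)) - B.
        (\<forall>j\<in>{1..N-(1::nat)}. z j \<in> S2 \<and> c / N < norm (x - z j)) \<and>
        (\<Sum>j=1..N-(1::nat). norm (x - z j) powr (- 2)) \<le> \<eta> * (real N)\<^sup>2 \<and>
        cmod ((\<Sum>j=1..N-(1::nat). kern (wcoord x) (z j)) / N - phi \<mu> (wcoord x)) \<le>
          \<eta> + 2 * (c / N) powr \<delta> * moment_bound (1 + \<delta>) + cmod (phi \<mu> (wcoord x)) / N)"
proof -
  define m where "m = c powr (\<delta> - 1) * moment_bound (1 + \<delta>)"
  have m0: "m \<ge> 0" using moment_bound_pos[of "1 + \<delta>"] \<delta> by (simp add: m_def)
  \<comment> \<open>The three summands bound \<open>B1\<close>, \<open>B2\<close> and the two copies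
    of \<open>B3\<close>.\<close>
  define C where "C = K * c\<^sup>2 + m / \<eta> + 2 * (16 * m / \<eta>\<^sup>2)"
  have main: "\<exists>B \<in> sets (Pi\<^sub>M {1..N-(1::nat)} (\<lambda>_. \<mu>)).
     measure (Pi\<^sub>M {1..N-(1::nat)} (\<lambda>_. \<mu>)) B \<le> C * N powr (- \<delta>) \<and>
     (\<forall>z \<in> space (Pi\<^sub>M {1..N-(1::nat)} (\<lambda>_. \<mu>)) - B.
        (\<forall>j\<in>{1..N-(1::nat)}. z j \<in> S2 \<and> c / N < norm (x - z j)) \<and>
        (\<Sum>j=1..N-(1::nat). norm (x - z j) powr (- 2)) \<le> \<eta> * (real N)\<^sup>2 \<and>
        cmod ((\<Sum>j=1..N-(1::nat). kern (wcoord x) (z j)) / N - phi \<mu> (wcoord x)) \<le>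
          \<eta> + 2 * (c / N) powr \<delta> * moment_bound (1 + \<delta>) + cmod (phi \<mu> (wcoord x)) / N)"
    if N: "N \<ge> 1" for N :: nat
  proof -
    define I where "I = {1..N-1}"
    define P where "P = Pi\<^sub>M I (\<lambda>_. \<mu>)"
    interpret P: prob_space P unfolding P_def by (rule prob_space_PiM_const)
    define t where "t = c / N"
    have N0: "real N > 0" using N by simp
    have t: "t > 0" using c N0 by (simp add: t_def)
    have I: "finite I" "real (card I) \<le> N" by (auto simp: I_def)
    have x': "x \<in> S2" using x by simp
    define q where "q \<zeta> = (if norm (x - \<zeta>) \<le> t then 0 else norm (x - \<zeta>) powr (- 2))" for \<zeta>
    define Y where "Y = trunc_kern x t"
    have q: "integrable \<mu> q" "(\<integral>\<zeta>. q \<zeta> \<partial>\<mu>) \<le> t powr (\<delta> - 1) * moment_bound (1 + \<delta>)"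
      using truncated_second_moment[OF x' t \<delta>] by (simp_all add: q_def[abs_def])
    have q0: "q \<zeta> \<ge> 0" for \<zeta> by (simp add: q_def)
    have tm: "t powr (\<delta> - 1) * moment_bound (1 + \<delta>) = m * N powr (1 - \<delta>)"
      using c N0 by (simp add: t_def m_def powr_divide powr_diff field_simps)
    \<comment> \<open>With \<open>t = c / N\<close> the truncated moment is of order
      \<open>N powr (1 - \<delta>)\<close>; summing at most \<open>N\<close> terms falls short of
      \<open>(real N)\<^sup>2\<close> by the factor \<open>N powr (- \<delta>)\<close>, which
      becomes the final rate.\<close>
    have Nq: "card I * (\<integral>\<zeta>. q \<zeta> \<partial>\<mu>) \<le> m * (real N)\<^sup>2 * N powr (- \<delta>)"
    proof -
      have "card I * (\<integral>\<zeta>. q \<zeta> \<partial>\<mu>) \<le> N * (m * N powr (1 - \<delta>))"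
        using I(2) q(2) unfolding tm by (intro mult_mono) (auto intro: Bochner_Integration.integral_nonneg q0)
      also have "N powr (1 - \<delta>) = N * N powr (- \<delta>)"
        using N0 by (simp add: powr_diff powr_minus_divide)
      finally show ?thesis by (simp add: power2_eq_square mult_ac)
    qed
    have Y: "integrable \<mu> Y" "\<And>z. \<zeta> \<in> S2 \<Longrightarrow> (cmod (Y \<zeta>))\<^sup>2 \<le> 4 * q \<zeta>" for \<zeta>
    proof -
      show "integrable \<mu> Y" unfolding Y_def by (rule integrable_trunc_kern[OF x])
      assume \<zeta>: "\<zeta> \<in> S2"
      show "(cmod (Y \<zeta>))\<^sup>2 \<le> 4 * q \<zeta>"
      proof (cases "norm (x - \<zeta>) \<le> t")
        case False
        have "(cmod (kern (wcoord x) \<zeta>))\<^sup>2 \<le> (2 * norm (x - \<zeta>) powr (- 1))\<^sup>2"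
          by (intro power_mono norm_kern_le x \<zeta>) auto
        also have "\<dots> = 4 * norm (x - \<zeta>) powr (- 2)"
        proof -
          have "(norm (x - \<zeta>) powr (- 1))\<^sup>2 = norm (x - \<zeta>) powr (- 2)"
            unfolding power2_eq_square powr_add[symmetric] by simp
          then show ?thesis unfolding power_mult_distrib by simp
        qed
        finally show ?thesis using False by (simp add: Y_def q_def trunc_kern_def)
      qed (simp add: Y_def q_def trunc_kern_def)
    qed
    define B1 where "B1 = {z \<in> space P. \<exists>j\<in>I. z j \<in> {\<zeta> \<in> S2. norm (x - \<zeta>) \<le> t}}"
    define B2 where "B2 = {z \<in> space P. (\<Sum>j\<in>I. q (z j)) \<ge> \<eta> * (real N)\<^sup>2}"
    \<comment> \<open>The weak law is for real functions, so \<open>g\<close> stands for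
      \<open>Re\<close> or \<open>Im\<close>. The threshold \<open>\<eta> / 2 * N\<close> for each
      part adds up to \<open>\<eta> * N\<close> for the modulus.\<close>
    define B3 where "B3 g = {z \<in> space P. \<bar>(\<Sum>j\<in>I. g (Y (z j))) - card I * (\<integral>\<zeta>. g (Y \<zeta>) \<partial>\<mu>)\<bar> \<ge> \<eta> / 2 * N}"
      for g :: "complex \<Rightarrow> real"
    have m_comp: "(\<lambda>z. h (z j)) \<in> borel_measurable P"
      if "j \<in> I" "h \<in> borel_measurable \<mu>" for j and h :: "_ \<Rightarrow> real"
      unfolding P_def using that by measurable
    have B1: "B1 \<in> sets P" "measure P B1 \<le> K * c\<^sup>2 * N powr (- \<delta>)"
    proof -
      have A: "{\<zeta> \<in> S2. norm (x - \<zeta>) \<le> t} \<in> sets \<mu>"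
        unfolding sets_eq by (rule cap_measurable)
      show "B1 \<in> sets P"
        unfolding B1_def P_def by (rule union_bound_PiM(1)[OF I(1) A])
      have "measure \<mu> {\<zeta> \<in> S2. norm (x - \<zeta>) \<le> t} \<le> K * t\<^sup>2"
        using cap_bound[OF x', of t] t K_pos by (simp add: emeasure_eq_measure ennreal_le_iff)
      then have "measure P B1 \<le> N * (K * t\<^sup>2)"
        unfolding B1_def P_def using I(2) t K_pos
        by (intro order_trans[OF union_bound_PiM(2)[OF I(1) A]] mult_mono) auto
      also have "\<dots> = K * c\<^sup>2 * N powr (- 1)"
        using N0 by (simp add: t_def powr_minus_divide power2_eq_square field_simps)
      \<comment> \<open>The union bound has the better rate \<open>1 / N\<close>, weakened here to
        the common one.\<close>
      also have "\<dots> \<le> K * c\<^sup>2 * N powr (- \<delta>)"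
        using N \<delta> K_pos by (intro mult_left_mono powr_mono) auto
      finally show "measure P B1 \<le> K * c\<^sup>2 * N powr (- \<delta>)" .
    qed
    have B2: "B2 \<in> sets P" "measure P B2 \<le> m / \<eta> * N powr (- \<delta>)"
    proof -
      have "(\<lambda>z. \<Sum>j\<in>I. q (z j)) \<in> borel_measurable P"
        by (intro borel_measurable_sum m_comp borel_measurable_integrable q)
      then show "B2 \<in> sets P" unfolding B2_def by measurable
      have "measure P B2 \<le> card I * (\<integral>\<zeta>. q \<zeta> \<partial>\<mu>) / (\<eta> * (real N)\<^sup>2)"
        unfolding B2_def P_def using \<eta> N0 by (intro Markov_sum_PiM I q q0) auto
      also have "\<dots> \<le> m * (real N)\<^sup>2 * N powr (- \<delta>) / (\<eta> * (real N)\<^sup>2)"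
        using Nq \<eta> by (intro divide_right_mono) auto
      also have "\<dots> = m / \<eta> * N powr (- \<delta>)" using N0 by simp
      finally show "measure P B2 \<le> m / \<eta> * N powr (- \<delta>)" .
    qed
    have B3: "B3 g \<in> sets P" "measure P (B3 g) \<le> 16 * m / \<eta>\<^sup>2 * N powr (- \<delta>)"
      if g: "\<And>f. integrable \<mu> f \<Longrightarrow> integrable \<mu> (\<lambda>\<zeta>. g (f \<zeta>))" "\<And>y. \<bar>g y\<bar> \<le> cmod y" for g
    proof -
      have i1: "integrable \<mu> (\<lambda>\<zeta>. g (Y \<zeta>))" by (intro g Y)
      have le: "(g (Y \<zeta>))\<^sup>2 \<le> 4 * q \<zeta>" if "\<zeta> \<in> S2" for \<zeta>
        using power_mono[OF g(2)[of "Y \<zeta>"] abs_ge_zero, of 2] Y(2)[OF that] by simp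
      have i2: "integrable \<mu> (\<lambda>\<zeta>. (g (Y \<zeta>))\<^sup>2)"
      proof (rule Bochner_Integration.integrable_bound)
        show "integrable \<mu> (\<lambda>\<zeta>. 4 * q \<zeta>)" using q(1) by simp
        show "(\<lambda>\<zeta>. (g (Y \<zeta>))\<^sup>2) \<in> borel_measurable \<mu>"
          using borel_measurable_integrable[OF i1] by measurable
        show "AE \<zeta> in \<mu>. norm ((g (Y \<zeta>))\<^sup>2) \<le> norm (4 * q \<zeta>)"
          using le q0 by (intro AE_I2) (simp add: space_eq)
      qed
      have "(\<lambda>z. \<bar>(\<Sum>j\<in>I. g (Y (z j))) - card I * (\<integral>\<zeta>. g (Y \<zeta>) \<partial>\<mu>)\<bar>) \<in> borel_measurable P"
        by (intro borel_measurable_abs borel_measurable_diff borel_measurable_sum m_comp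
            borel_measurable_integrable i1 borel_measurable_const)
      then show "B3 g \<in> sets P" unfolding B3_def by measurable
      have "measure P (B3 g) \<le> card I * (\<integral>\<zeta>. (g (Y \<zeta>))\<^sup>2 \<partial>\<mu>) / (\<eta> / 2 * N)\<^sup>2"
        unfolding B3_def P_def using \<eta> N0 by (intro weak_law_PiM I i1 i2) auto
      also have "(\<integral>\<zeta>. (g (Y \<zeta>))\<^sup>2 \<partial>\<mu>) \<le> (\<integral>\<zeta>. 4 * q \<zeta> \<partial>\<mu>)"
        using i2 q(1) le by (intro integral_mono) (auto simp: space_eq)
      also have "(\<integral>\<zeta>. 4 * q \<zeta> \<partial>\<mu>) = 4 * (\<integral>\<zeta>. q \<zeta> \<partial>\<mu>)" by simp
      also have "card I * (4 * (\<integral>\<zeta>. q \<zeta> \<partial>\<mu>)) = 4 * (card I * (\<integral>\<zeta>. q \<zeta> \<partial>\<mu>))" by simp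
      also have "\<dots> \<le> 4 * (m * (real N)\<^sup>2 * N powr (- \<delta>))" using Nq by simp
      also have "4 * (m * (real N)\<^sup>2 * N powr (- \<delta>)) / (\<eta> / 2 * N)\<^sup>2 = 16 * m / \<eta>\<^sup>2 * N powr (- \<delta>)"
        using N0 \<eta> by (simp add: power_mult_distrib power_divide)
      finally show "measure P (B3 g) \<le> 16 * m / \<eta>\<^sup>2 * N powr (- \<delta>)"
        by (simp add: divide_right_mono mult_left_mono)
    qed
    have re: "integrable \<mu> (\<lambda>\<zeta>. Re (f \<zeta>))" and im: "integrable \<mu> (\<lambda>\<zeta>. Im (f \<zeta>))"
      if "integrable \<mu> f" for f
      using that by auto
    note B3_Re = B3[of Re, OF re abs_Re_le_cmod] and B3_Im = B3[of Im, OF im abs_Im_le_cmod]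
    define B where "B = B1 \<union> B2 \<union> (B3 Re \<union> B3 Im)"
    have BP: "B \<in> sets P" using B1 B2 B3_Re B3_Im by (simp add: B_def)
    have "measure P B \<le> measure P B1 + measure P B2 + (measure P (B3 Re) + measure P (B3 Im))"
      unfolding B_def using B1 B2 B3_Re B3_Im
      by (intro order_trans[OF measure_Un_le] add_mono order_refl measure_Un_le) auto
    also have "\<dots> \<le> K * c\<^sup>2 * N powr (- \<delta>) + m / \<eta> * N powr (- \<delta>) +
        (16 * m / \<eta>\<^sup>2 * N powr (- \<delta>) + 16 * m / \<eta>\<^sup>2 * N powr (- \<delta>))"
      by (intro add_mono B1(2) B2(2) B3_Re(2) B3_Im(2))
    also have "\<dots> = C * N powr (- \<delta>)"
      by (simp add: C_def algebra_simps)
    finally have mB: "measure P B \<le> C * N powr (- \<delta>)" .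
    have good: "(\<forall>j\<in>I. z j \<in> S2 \<and> t < norm (x - z j)) \<and>
        (\<Sum>j\<in>I. norm (x - z j) powr (- 2)) \<le> \<eta> * (real N)\<^sup>2 \<and>
        cmod ((\<Sum>j\<in>I. kern (wcoord x) (z j)) / N - phi \<mu> (wcoord x)) \<le>
          \<eta> + 2 * t powr \<delta> * moment_bound (1 + \<delta>) + cmod (phi \<mu> (wcoord x)) / N"
      if z: "z \<in> space P - B" for z
    proof -
      have zS: "z j \<in> S2" if "j \<in> I" for j
        using z that by (auto simp: P_def space_PiM space_eq)
      then have far: "t < norm (x - z j)" if "j \<in> I" for j
        using z that by (force simp: B_def B1_def)
      then have eq: "q (z j) = norm (x - z j) powr (- 2)" "Y (z j) = kern (wcoord x) (z j)" if "j \<in> I" for j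
        using that by (force simp: q_def Y_def trunc_kern_def)+
      have qs: "(\<Sum>j\<in>I. q (z j)) \<le> \<eta> * (real N)\<^sup>2"
        using z by (auto simp: B_def B2_def)
      define S where "S = (\<Sum>j\<in>I. Y (z j))"
      define E where "E = (\<integral>\<zeta>. Y \<zeta> \<partial>\<mu>)"
      have "\<bar>Re (S - card I * E)\<bar> \<le> \<eta> / 2 * N" "\<bar>Im (S - card I * E)\<bar> \<le> \<eta> / 2 * N"
        using z Y(1) by (auto simp: B_def B3_def S_def E_def)
      then have "cmod (S - card I * E) \<le> \<eta> * N"
        using cmod_le[of "S - card I * E"] by (simp add: algebra_simps)
      then have 1: "cmod ((S - card I * E) / N) \<le> \<eta>"
        using N0 by (simp add: norm_divide field_simps)
      have E: "cmod (E - phi \<mu> (wcoord x)) \<le> 2 * t powr \<delta> * moment_bound (1 + \<delta>)"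
        unfolding E_def Y_def by (rule integral_trunc_kern[OF x t \<delta>])
      \<comment> \<open>There are \<open>N - 1\<close> zeros but the sum is divided by
        \<open>N\<close>; the missing share of the mean is the term
        \<open>phi \<mu> (wcoord x) / N\<close>.\<close>
      have "card I = N - 1" by (simp add: I_def)
      then have "S / N - phi \<mu> (wcoord x) = (S - card I * E) / N +
          (of_nat (card I) / of_nat N * (E - phi \<mu> (wcoord x)) - phi \<mu> (wcoord x) / N)"
        using N0 by (simp add: field_simps of_nat_diff[OF N])
      also have "cmod \<dots> \<le> \<eta> + (2 * t powr \<delta> * moment_bound (1 + \<delta>) + cmod (phi \<mu> (wcoord x)) / N)"
      proof (intro norm_triangle_le add_mono 1 norm_triangle_le_diff)
        have "real (card I) / N * cmod (E - phi \<mu> (wcoord x)) \<le> 1 * cmod (E - phi \<mu> (wcoord x))"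
          using I(2) N0 by (intro mult_right_mono) auto
        with E show "cmod (of_nat (card I) / of_nat N * (E - phi \<mu> (wcoord x))) \<le> 2 * t powr \<delta> * moment_bound (1 + \<delta>)"
          by (simp add: norm_mult norm_divide)
      qed (simp add: norm_divide)
      finally have "cmod (S / N - phi \<mu> (wcoord x)) \<le>
          \<eta> + 2 * t powr \<delta> * moment_bound (1 + \<delta>) + cmod (phi \<mu> (wcoord x)) / N"
        by simp
      then show ?thesis
        using zS far qs by (simp add: eq S_def)
    qed
    show ?thesis
      using BP mB good unfolding P_def I_def t_def by blast
  qed
  show ?thesis by (intro exI[of _ C] allI impI main)
qed

end

section \<open>Measurability\<close>

text \<open>
  By compactness, \<open>F \<omega>\<close> has a zero in \<open>C\<close> iff it takes arbitrarily small values on a fixed countable dense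
  subset of \<open>C\<close>.
\<close>

lemma measurable_ex_zero_compact:
  fixes F :: "'a \<Rightarrow> 'b::{metric_space, second_countable_topology} \<Rightarrow> 'c::real_normed_vector"
  assumes C: "compact C"
    and cont: "\<And>\<omega>. \<omega> \<in> space M \<Longrightarrow> continuous_on C (F \<omega>)"
    and meas: "\<And>x. x \<in> C \<Longrightarrow> (\<lambda>\<omega>. norm (F \<omega> x)) \<in> borel_measurable M"
  shows "{\<omega> \<in> space M. \<exists>x\<in>C. F \<omega> x = 0} \<in> sets M"
proof -
  obtain T where T: "countable T" "T \<subseteq> C" "C \<subseteq> closure T"
    using separable by blast
  have "(\<exists>x\<in>C. F \<omega> x = 0) \<longleftrightarrow> (\<forall>n. \<exists>t\<in>T. norm (F \<omega> t) < 1 / real (Suc n))"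
    if \<omega>: "\<omega> \<in> space M" for \<omega>
  proof
    assume "\<exists>x\<in>C. F \<omega> x = 0"
    then obtain x where x: "x \<in> C" "F \<omega> x = 0" by blast
    show "\<forall>n. \<exists>t\<in>T. norm (F \<omega> t) < 1 / real (Suc n)"
    proof
      fix n
      obtain d where d: "d > 0" "\<And>y. y \<in> C \<Longrightarrow> dist y x < d \<Longrightarrow> dist (F \<omega> y) (F \<omega> x) < 1 / real (Suc n)"
        using cont[OF \<omega>] x(1) unfolding continuous_on_iff
        by (metis of_nat_0_less_iff zero_less_Suc zero_less_divide_1_iff)
      obtain t where "t \<in> T" "dist t x < d"
        using T(3) x(1) d(1) unfolding closure_approachable by (metis closure_approachable subsetD)
      then show "\<exists>t\<in>T. norm (F \<omega> t) < 1 / real (Suc n)"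
        using d(2)[of t] T(2) x(2) by (auto simp: dist_norm)
    qed
  next
    assume *: "\<forall>n. \<exists>t\<in>T. norm (F \<omega> t) < 1 / real (Suc n)"
    have "C \<noteq> {}" using * T(2) by auto
    moreover have "continuous_on C (\<lambda>x. norm (F \<omega> x))"
      using cont[OF \<omega>] by (rule continuous_on_norm)
    ultimately obtain x where x: "x \<in> C" "\<And>y. y \<in> C \<Longrightarrow> norm (F \<omega> x) \<le> norm (F \<omega> y)"
      using continuous_attains_inf[OF C] by blast
    have "norm (F \<omega> x) = 0"
    proof (rule ccontr)
      assume "norm (F \<omega> x) \<noteq> 0"
      then obtain n where "1 / real (Suc n) < norm (F \<omega> x)"
        using nat_approx_posE[of "norm (F \<omega> x)"] by auto
      moreover obtain t where "t \<in> T" "norm (F \<omega> t) < 1 / real (Suc n)" using * by blast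
      ultimately show False using x(2)[of t] T(2) by force
    qed
    then show "\<exists>x\<in>C. F \<omega> x = 0" using x(1) by auto
  qed
  then have "{\<omega> \<in> space M. \<exists>x\<in>C. F \<omega> x = 0} =
      {\<omega> \<in> space M. \<forall>n. \<exists>t\<in>T. norm (F \<omega> t) < 1 / real (Suc n)}"
    by blast
  also have "\<dots> = (\<Inter>n. \<Union>t\<in>T. {\<omega> \<in> space M. norm (F \<omega> t) < 1 / real (Suc n)})"
    by auto
  also have "\<dots> \<in> sets M"
  proof -
    have "(\<Union>t\<in>T. {\<omega> \<in> space M. norm (F \<omega> t) < 1 / real (Suc n)}) \<in> sets M" for n
    proof (intro sets.countable_UN'' T(1))
      fix t assume "t \<in> T"
      then have "(\<lambda>\<omega>. norm (F \<omega> t)) \<in> borel_measurable M" using meas T(2) by blast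
      then show "{\<omega> \<in> space M. norm (F \<omega> t) < 1 / real (Suc n)} \<in> sets M"
        by measurable
    qed
    then show ?thesis by (intro sets.countable_INT) auto
  qed
  finally show ?thesis .
qed

text \<open>Exhausting \<open>U\<close> by compact sets reduces existence to
  \<open>measurable_ex_zero_compact\<close>. Two distinct zeros form a zero of the pair map on one
  of the compact sets \<open>E n\<close> of pairs separated by at least \<open>1 / Suc n\<close>, so
  failure of uniqueness is also a countable union of measurable events.\<close>

lemma measurable_ex1_zero:
  fixes F :: "'a \<Rightarrow> 'b::euclidean_space \<Rightarrow> 'c::real_normed_vector"
  assumes U: "open U" "closed S"
    and cont: "\<And>\<omega>. \<omega> \<in> space M \<Longrightarrow> continuous_on (U \<inter> S) (F \<omega>)"
    and meas: "\<And>x. x \<in> U \<inter> S \<Longrightarrow> (\<lambda>\<omega>. norm (F \<omega> x)) \<in> borel_measurable M"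
  shows "{\<omega> \<in> space M. \<exists>!x. x \<in> U \<inter> S \<and> F \<omega> x = 0} \<in> sets M"
proof -
  obtain C where C: "\<And>n. compact (C n)" "\<And>n. C n \<subseteq> U" "\<And>n. C n \<subseteq> interior (C (Suc n))" "\<Union> (range C) = U"
    using open_Union_compact_subsets[OF U(1)] by metis
  have mono: "C m \<subseteq> C n" if "m \<le> n" for m n
    using that by (induction rule: dec_induct) (use C(3) interior_subset in blast)+
  define D where "D n = C n \<inter> S" for n
  have D: "compact (D n)" "D n \<subseteq> U \<inter> S" for n
    using C(1,2) U(2) by (auto simp: D_def intro: compact_Int_closed)
  have D_ex: "\<exists>n. x \<in> D n" if "x \<in> U \<inter> S" for x
    using that C(4) by (auto simp: D_def)
  have D_mono: "D m \<subseteq> D n" if "m \<le> n" for m n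
    using mono[OF that] by (auto simp: D_def)
  define E where "E n = D n \<times> D n \<inter> {p. 1 / real (Suc n) \<le> dist (fst p) (snd p)}" for n
  have E: "compact (E n)" for n
    unfolding E_def
    by (intro compact_Int_closed compact_Times D closed_Collect_le continuous_intros)
  have one: "{\<omega> \<in> space M. \<exists>x\<in>D n. F \<omega> x = 0} \<in> sets M" for n
    using D(2)[of n] by (intro measurable_ex_zero_compact D(1) meas)
      (auto intro: continuous_on_subset[OF cont])
  have two: "{\<omega> \<in> space M. \<exists>p\<in>E n. (F \<omega> (fst p), F \<omega> (snd p)) = 0} \<in> sets M" for n
  proof (rule measurable_ex_zero_compact[OF E])
    fix \<omega> assume \<omega>: "\<omega> \<in> space M"
    have "fst ` E n \<subseteq> U \<inter> S" "snd ` E n \<subseteq> U \<inter> S"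
      using D(2)[of n] by (auto simp: E_def)
    then show "continuous_on (E n) (\<lambda>p. (F \<omega> (fst p), F \<omega> (snd p)))"
      by (intro continuous_on_Pair continuous_on_compose2[OF cont[OF \<omega>]] continuous_intros)
  next
    fix p assume "p \<in> E n"
    then have "fst p \<in> U \<inter> S" "snd p \<in> U \<inter> S"
      using D(2)[of n] by (auto simp: E_def)
    from this[THEN meas] show "(\<lambda>\<omega>. norm (F \<omega> (fst p), F \<omega> (snd p))) \<in> borel_measurable M"
      unfolding norm_Pair by measurable
  qed
  have "(\<exists>!x. x \<in> U \<inter> S \<and> F \<omega> x = 0) \<longleftrightarrow>
      (\<exists>n. \<exists>x\<in>D n. F \<omega> x = 0) \<and> \<not> (\<exists>n. \<exists>p\<in>E n. (F \<omega> (fst p), F \<omega> (snd p)) = 0)" (is "?l \<longleftrightarrow> ?r")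
    for \<omega>
  proof
    assume ?l
    then obtain x where x: "x \<in> U \<inter> S" "F \<omega> x = 0" "\<And>y. y \<in> U \<inter> S \<Longrightarrow> F \<omega> y = 0 \<Longrightarrow> y = x"
      by blast
    have "\<not> (\<exists>p\<in>E n. (F \<omega> (fst p), F \<omega> (snd p)) = 0)" for n
    proof
      assume "\<exists>p\<in>E n. (F \<omega> (fst p), F \<omega> (snd p)) = 0"
      then obtain p where p: "p \<in> E n" "F \<omega> (fst p) = 0" "F \<omega> (snd p) = 0"
        by (auto simp: zero_prod_def)
      have "fst p \<in> U \<inter> S" "snd p \<in> U \<inter> S"
        using p(1) D(2)[of n] by (auto simp: E_def)
      then have "fst p = snd p" using x(3) p(2,3) by metis
      moreover have "1 / real (Suc n) > 0" by simp
      ultimately show False using p(1) by (simp add: E_def)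
    qed
    then show ?r using x D_ex by blast
  next
    assume r: ?r
    then obtain n x where x: "x \<in> D n" "F \<omega> x = 0" by blast
    have "y = x" if y: "y \<in> U \<inter> S" "F \<omega> y = 0" for y
    proof (rule ccontr)
      assume "y \<noteq> x"
      then obtain k where k: "1 / real (Suc k) < dist y x"
        using nat_approx_posE[of "dist y x"] by auto
      obtain m where m: "y \<in> D m" using D_ex y(1) by blast
      \<comment> \<open>At stage \<open>l\<close> both zeros belong to the exhausting set and their
        distance is resolved.\<close>
      define l where "l = max n (max m k)"
      have "1 / real (Suc l) \<le> 1 / real (Suc k)"
        by (intro divide_left_mono) (auto simp: l_def)
      then have "(y, x) \<in> E l"
        using k m x(1) D_mono[of n l] D_mono[of m l] by (auto simp: E_def l_def le_max_iff_disj)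
      then show False using r x(2) y(2) by (force simp: zero_prod_def)
    qed
    then show ?l using x D(2)[of n] by blast
  qed
  then have "{\<omega> \<in> space M. \<exists>!x. x \<in> U \<inter> S \<and> F \<omega> x = 0} =
      (\<Union>n. {\<omega> \<in> space M. \<exists>x\<in>D n. F \<omega> x = 0}) -
      (\<Union>n. {\<omega> \<in> space M. \<exists>p\<in>E n. (F \<omega> (fst p), F \<omega> (snd p)) = 0})"
    by auto
  also have "\<dots> \<in> sets M"
    using one two by (intro sets.Diff sets.countable_UN) auto
  finally show ?thesis .
qed

section \<open>Measurability of the event in the theorem\<close>

lemma holomorphic_rpoly: "rpoly N \<xi> zs holomorphic_on - {0}"
proof -
  have [holomorphic_intros]: "lin_factor \<zeta> holomorphic_on A" for \<zeta> A
    by (cases "\<zeta> = origin_pt") (auto simp: lin_factor_def[abs_def] intro!: holomorphic_intros)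
  show ?thesis
    unfolding rpoly_def[abs_def] by (intro holomorphic_intros) auto
qed

lemma continuous_on_wcoord: "continuous_on (S2 - {origin_pt}) wcoord"
  unfolding wcoord_eq using S2_third_less_1 by (intro continuous_intros) force

text \<open>On the range of \<open>sdist\<close> the cosine is strictly decreasing, so the disk is
  cut out by an open half-space, and the closed sphere is the only other constraint.\<close>

lemma geo_disk_eq:
  assumes "c \<in> S2" "0 \<le> \<rho>" "\<rho> \<le> pi"
  shows "geo_disk c \<rho> = {x. cos \<rho> < c \<bullet> x} \<inter> S2"
proof -
  have "sdist c x < \<rho> \<longleftrightarrow> cos \<rho> < c \<bullet> x" if "x \<in> S2" for x
    using S2_inner_bounds[OF assms(1) that] assms(2,3) cos_mono_less_eq[of \<rho> "sdist c x"]
      norm_eq_sin_sdist(2,3)[OF assms(1) that]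
    by (simp add: sdist_def)
  then show ?thesis by (auto simp: geo_disk_def)
qed

context S2_measure
begin

lemma measurable_rpoly: "(\<lambda>zs. rpoly N \<xi> zs w) \<in> borel_measurable (Pi\<^sub>M {1..N-1} (\<lambda>_. \<mu>))"
proof -
  have "(\<lambda>\<zeta>. lin_factor \<zeta> w) \<in> borel_measurable \<mu>"
    unfolding lin_factor_def by (rule borel_measurable_\<mu>) measurable
  then have "(\<lambda>zs. lin_factor (zs j) w) \<in> borel_measurable (Pi\<^sub>M {1..N-1} (\<lambda>_. \<mu>))"
    if "j \<in> {1..N-1}" for j
    using that by measurable
  then show ?thesis
    unfolding rpoly_def by (intro borel_measurable_times borel_measurable_const borel_measurable_prod)
qed

text \<open>By holomorphy off 0, the derivative is the limit of difference quotients along one fixed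
  sequence \<open>h\<close>, each of them measurable in the zeros.\<close>

lemma measurable_deriv_rpoly:
  assumes "w \<noteq> 0"
  shows "(\<lambda>zs. deriv (rpoly N \<xi> zs) w) \<in> borel_measurable (Pi\<^sub>M {1..N-1} (\<lambda>_. \<mu>))"
proof (rule borel_measurable_LIMSEQ_metric)
  define h :: "nat \<Rightarrow> complex" where "h n = of_real (inverse (real (Suc n)))" for n
  have h: "h n \<noteq> 0" for n unfolding h_def by (simp del: of_nat_Suc)
  have h_lim: "h \<longlonglongrightarrow> 0"
    unfolding h_def using tendsto_of_real[OF LIMSEQ_inverse_real_of_nat, where 'a = complex]
    by (simp only: of_real_0)
  show "(\<lambda>zs. (rpoly N \<xi> zs (w + h n) - rpoly N \<xi> zs w) / h n) \<in> borel_measurable (Pi\<^sub>M {1..N-1} (\<lambda>_. \<mu>))" for n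
    by (intro borel_measurable_divide borel_measurable_diff measurable_rpoly borel_measurable_const)
  show "(\<lambda>n. (rpoly N \<xi> zs (w + h n) - rpoly N \<xi> zs w) / h n) \<longlonglongrightarrow> deriv (rpoly N \<xi> zs) w" for zs
  proof -
    have "(rpoly N \<xi> zs has_field_derivative deriv (rpoly N \<xi> zs) w) (at w)"
      using holomorphic_derivI[OF holomorphic_rpoly open_Compl[OF closed_singleton]] assms by simp
    then have "(\<lambda>h. (rpoly N \<xi> zs (w + h) - rpoly N \<xi> zs w) / h) \<midarrow>0\<rightarrow> deriv (rpoly N \<xi> zs) w"
      unfolding DERIV_def .
    moreover have "filterlim h (at 0) sequentially"
      using h h_lim by (simp add: filterlim_at)
    ultimately show ?thesis
      by (rule filterlim_compose)
  qed
qed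

text \<open>A lower bound for \<open>measure\<close> of the event by way of monotonicity requires
  the event itself to be measurable. Removing the two poles of the sphere keeps \<open>U\<close>
  open and keeps \<open>wcoord\<close> continuous and nonzero on it.\<close>

lemma measurable_unique_critical_point:
  assumes c: "c \<in> S2" and \<rho>: "0 \<le> \<rho>" "\<rho> \<le> pi"
  shows "{zs \<in> space (Pi\<^sub>M {1..N-1} (\<lambda>_. \<mu>)). \<exists>!x. x \<in> geo_disk c \<rho> \<and> is_critical_point N \<xi> zs x}
    \<in> sets (Pi\<^sub>M {1..N-1} (\<lambda>_. \<mu>))"
proof -
  define U where "U = {x. cos \<rho> < c \<bullet> x} - {pole_pt, origin_pt}"
  have U: "open U"
    unfolding U_def by (intro open_Diff finite_imp_closed open_Collect_less continuous_intros) auto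
  have iff: "x \<in> geo_disk c \<rho> \<and> is_critical_point N \<xi> zs x \<longleftrightarrow>
      x \<in> U \<inter> S2 \<and> deriv (rpoly N \<xi> zs) (wcoord x) = 0" for x zs
    by (auto simp: geo_disk_eq[OF c \<rho>] is_critical_point_def U_def)
  have sub: "U \<inter> S2 \<subseteq> S2 - {origin_pt}" by (auto simp: U_def)
  have nz: "wcoord x \<noteq> 0" if "x \<in> U \<inter> S2" for x
    using wcoord_eq_0_iff[of x] that by (auto simp: U_def)
  show ?thesis
    unfolding iff
  proof (rule measurable_ex1_zero[OF U closed_S2])
    fix zs
    have "continuous_on (- {0}) (deriv (rpoly N \<xi> zs))"
      by (intro holomorphic_on_imp_continuous_on holomorphic_deriv holomorphic_rpoly open_Compl closed_singleton)
    then show "continuous_on (U \<inter> S2) (\<lambda>x. deriv (rpoly N \<xi> zs) (wcoord x))"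
      using continuous_on_subset[OF continuous_on_wcoord sub] by (rule continuous_on_compose2) (use nz in auto)
  next
    fix x assume "x \<in> U \<inter> S2"
    then show "(\<lambda>zs. norm (deriv (rpoly N \<xi> zs) (wcoord x))) \<in> borel_measurable (Pi\<^sub>M {1..N-1} (\<lambda>_. \<mu>))"
      by (intro borel_measurable_norm[THEN measurable_compose[rotated]] measurable_deriv_rpoly nz)
  qed
qed

end

section \<open>The theorem\<close>

lemma wcoord_near:
  assumes \<xi>: "\<xi> \<in> S2 - {origin_pt}" and x: "x \<in> S2" and n: "norm (x - \<xi>) \<le> (1 - \<xi> $ 3) / 2"
  shows "x \<noteq> origin_pt" "cmod (wcoord x - wcoord \<xi>) \<le> norm (x - \<xi>) / ((1 - \<xi> $ 3) / 2)"
proof -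
  have pos: "1 - \<xi> $ 3 > 0" using S2_third_less_1[of \<xi>] \<xi> by auto
  have "\<bar>x $ 3 - \<xi> $ 3\<bar> \<le> (1 - \<xi> $ 3) / 2"
    using component_le_norm_cart[of "x - \<xi>" 3] n by simp
  then have c: "(1 - \<xi> $ 3) / 2 \<le> 1 - x $ 3"
    using abs_ge_self[of "x $ 3 - \<xi> $ 3"] by argo
  then show no: "x \<noteq> origin_pt"
    using pos by (auto simp: origin_pt_def)
  show "cmod (wcoord x - wcoord \<xi>) \<le> norm (x - \<xi>) / ((1 - \<xi> $ 3) / 2)"
    using x no \<xi> pos c by (intro wcoord_Lipschitz) auto
qed

text \<open>The defining equation says \<open>w - wcoord \<xi> = - 1 / (N * A N)\<close>, where
  \<open>A N\<close> tends to \<open>a\<close> because \<open>W N\<close> approaches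
  \<open>\<xi>\<close> and \<open>phi \<mu>\<close> is continuous.\<close>

lemma (in S2_measure) averaged_critical_point_asymp:
  assumes \<xi>: "\<xi> \<in> S2 - exceptional_set \<mu>" and W: "averaged_critical_point \<mu> \<xi> D W" and \<epsilon>: "\<epsilon> > 0"
  defines "a \<equiv> - 1 / wcoord \<xi> + phi \<mu> (wcoord \<xi>)"
  shows "\<forall>\<^sub>F N in sequentially. N \<in> D \<longrightarrow>
    cmod (wcoord (W N) - (wcoord \<xi> - 1 / (of_nat N * a))) \<le> \<epsilon> / N"
proof -
  have \<xi>': "\<xi> \<in> S2 - {origin_pt}" "\<xi> \<noteq> pole_pt" and a: "a \<noteq> 0"
    using \<xi> by (auto simp: exceptional_set_def a_def)
  then have x0: "wcoord \<xi> \<noteq> 0" using wcoord_eq_0_iff by blast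
  have WD: "N \<ge> 1" "W N \<in> S2 - {origin_pt}" "W N \<noteq> \<xi>" "W N \<noteq> pole_pt"
    "- of_nat N / wcoord (W N) + 1 / (wcoord (W N) - wcoord \<xi>) + of_nat (N - 1) * phi \<mu> (wcoord (W N)) = 0"
    if "N \<in> D" for N
    using W that by (auto simp: averaged_critical_point_def)
  obtain b where b: "b > 0" "\<And>N. N \<in> D \<Longrightarrow> sdist (W N) \<xi> \<le> b / N"
    using W by (auto simp: averaged_critical_point_def)
  \<comment> \<open>Filling in \<open>\<xi>\<close> outside \<open>D\<close> yields a sequence
    defined for all \<open>N\<close>, so ordinary limits can be taken.\<close>
  define v where "v N = (if N \<in> D then W N else \<xi>)" for N
  have v: "v N \<in> S2 - {origin_pt}" for N using WD(2) \<xi>' by (auto simp: v_def)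
  have vn: "norm (v N - \<xi>) \<le> b / N" for N
    using norm_le_sdist[of "W N" \<xi>] b WD(2)[of N] \<xi>' by (auto simp: v_def intro: order_trans)
  define c where "c = (1 - \<xi> $ 3) / 2"
  have c: "c > 0" using S2_third_less_1[of \<xi>] \<xi>' by (auto simp: c_def)
  have "(\<lambda>N. b / real N) \<longlonglongrightarrow> 0" by real_asymp
  then have "\<forall>\<^sub>F N in sequentially. b / real N < c"
    using c by (rule order_tendstoD)
  then have "\<forall>\<^sub>F N in sequentially. norm (wcoord (v N) - wcoord \<xi>) \<le> b / N / c"
  proof eventually_elim
    case (elim N)
    then have "norm (v N - \<xi>) \<le> c" using vn[of N] by linarith
    then have "norm (wcoord (v N) - wcoord \<xi>) \<le> norm (v N - \<xi>) / c"
      using wcoord_near(2)[OF \<xi>'(1), of "v N"] v[of N] by (simp add: c_def)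
    also have "\<dots> \<le> b / N / c" using vn[of N] c by (intro divide_right_mono) auto
    finally show ?case .
  qed
  moreover have "(\<lambda>N. b / real N / c) \<longlonglongrightarrow> 0" using c by real_asymp
  ultimately have "(\<lambda>N. wcoord (v N) - wcoord \<xi>) \<longlonglongrightarrow> 0"
    by (rule Lim_null_comparison)
  then have lim_w: "(\<lambda>N. wcoord (v N)) \<longlonglongrightarrow> wcoord \<xi>"
    by (simp add: LIM_zero_iff)
  have "(\<lambda>N. sqrt (2 * cmod (wcoord (v N) - wcoord \<xi>)) * 2 powr (3/2) * (2 * moment_bound (3/2)))
      \<longlonglongrightarrow> sqrt (2 * cmod (wcoord \<xi> - wcoord \<xi>)) * 2 powr (3/2) * (2 * moment_bound (3/2))"
    by (intro tendsto_intros lim_w)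
  then have "(\<lambda>N. phi \<mu> (wcoord (v N)) - phi \<mu> (wcoord \<xi>)) \<longlonglongrightarrow> 0"
    by (intro Lim_null_comparison[OF always_eventually[OF allI[OF norm_phi_diff_le[OF v \<xi>'(1)]]]]) simp
  then have lim_phi: "(\<lambda>N. phi \<mu> (wcoord (v N))) \<longlonglongrightarrow> phi \<mu> (wcoord \<xi>)"
    by (simp add: LIM_zero_iff)
  define A where "A N = - 1 / wcoord (v N) + of_real (1 - 1 / real N) * phi \<mu> (wcoord (v N))" for N
  have "(\<lambda>N. 1 - 1 / real N) \<longlonglongrightarrow> 1" by real_asymp
  from tendsto_of_real[OF this, where 'a = complex] have "A \<longlonglongrightarrow> - 1 / wcoord \<xi> + of_real 1 * phi \<mu> (wcoord \<xi>)"
    unfolding A_def by (intro tendsto_add tendsto_mult tendsto_divide tendsto_const lim_w lim_phi x0)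
  then have "A \<longlonglongrightarrow> a" by (simp add: a_def)
  \<comment> \<open>The first threshold keeps \<open>A N\<close> away from 0; the second is chosen
    so that the final quotient is exactly \<open>\<epsilon> / N\<close>.\<close>
  then have "\<forall>\<^sub>F N in sequentially. dist (A N) a < min (cmod a / 2) (\<epsilon> * (cmod a)\<^sup>2 / 2)"
    using a \<epsilon> by (intro tendstoD) auto
  then show ?thesis
  proof eventually_elim
    case (elim N)
    show ?case
    proof
      assume N: "N \<in> D"
      define w where "w = wcoord (W N)"
      have N0: "real N > 0" using WD(1)[OF N] by simp
      have close: "cmod (A N - a) \<le> cmod a / 2" "cmod (A N - a) \<le> \<epsilon> * (cmod a)\<^sup>2 / 2"
        using elim by (auto simp: dist_norm)
      have ge: "cmod (A N) \<ge> cmod a / 2"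
        using close(1) norm_triangle_ineq2[of a "a - A N"] by (simp add: norm_minus_commute)
      have ca: "cmod a > 0" using a by simp
      have AN: "A N \<noteq> 0" using ge ca by fastforce
      have wx: "w \<noteq> wcoord \<xi>"
        using wcoord_eq_iff[OF WD(2)[OF N] \<xi>'(1)] WD(3)[OF N] by (simp add: w_def)
      have eqn: "of_nat N * A N = - of_nat N / w + of_nat (N - 1) * phi \<mu> w"
        using N N0 WD(1)[OF N] by (simp add: A_def v_def w_def field_simps of_nat_diff)
      have "1 / (w - wcoord \<xi>) + of_nat N * A N = 0"
        unfolding eqn using WD(5)[OF N] by (simp add: w_def algebra_simps)
      then have "1 / (w - wcoord \<xi>) = - (of_nat N * A N)"
        by (simp add: eq_neg_iff_add_eq_0)
      then have "w - wcoord \<xi> = - 1 / (of_nat N * A N)"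
        using wx AN N0 by (simp add: field_simps)
      then have "w - (wcoord \<xi> - 1 / (of_nat N * a)) = 1 / (of_nat N * a) - 1 / (of_nat N * A N)"
        by (simp add: algebra_simps)
      also have "\<dots> = (A N - a) / (of_nat N * (a * A N))"
        using a AN N0 by (simp add: field_simps)
      finally have "cmod (w - (wcoord \<xi> - 1 / (of_nat N * a))) = cmod (A N - a) / (N * (cmod a * cmod (A N)))"
        by (simp add: norm_divide norm_mult)
      also have "\<dots> \<le> cmod (A N - a) / (N * (cmod a * (cmod a / 2)))"
        using ge ca N0 by (intro divide_left_mono mult_left_mono mult_pos_pos) auto
      also have "\<dots> \<le> (\<epsilon> * (cmod a)\<^sup>2 / 2) / (N * (cmod a * (cmod a / 2)))"
        using close(2) N0 by (intro divide_right_mono) auto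
      also have "\<dots> = \<epsilon> / N" using ca by (simp add: power2_eq_square)
      finally show "cmod (wcoord (W N) - (wcoord \<xi> - 1 / (of_nat N * a))) \<le> \<epsilon> / N"
        by (simp add: w_def)
    qed
  qed
qed

text \<open>Geodesic distance is at most four times coordinate distance, so a coordinate error below
  \<open>r / 4 / N\<close> puts the zero inside the disk. Uniqueness is inherited from
  \<open>B\<close>, which contains the coordinates of the whole disk.\<close>

lemma ex1_critical_point_in_disk:
  fixes r \<epsilon> :: real
  assumes W: "W \<in> S2 - {origin_pt}" and N: "N > 0" and r: "r > 0"
    and chart: "\<And>x. x \<in> geo_disk W (r / N) \<Longrightarrow> x \<noteq> origin_pt \<and> wcoord x \<in> B"
    and w: "w \<noteq> 0" "w \<in> B" "deriv (rpoly n \<xi> zs) w = 0"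
    and uniq: "\<And>v. v \<in> B \<Longrightarrow> deriv (rpoly n \<xi> zs) v = 0 \<Longrightarrow> v = w"
    and near: "cmod (w - wcoord W) < r / 4 / N"
  shows "\<exists>!x. x \<in> geo_disk W (r / N) \<and> is_critical_point n \<xi> zs x"
proof -
  obtain x where x: "x \<in> S2 - {origin_pt}" "wcoord x = w"
    by (rule wcoord_surj)
  have "sdist W x \<le> 2 * norm (W - x)" using W x by (intro sdist_le_norm) auto
  also have "\<dots> \<le> 4 * cmod (wcoord W - wcoord x)" using norm_le_wcoord[OF W x(1)] by simp
  also have "\<dots> < r / N" using near by (simp add: x(2) norm_minus_commute)
  finally have xd: "x \<in> geo_disk W (r / N)" using x by (simp add: geo_disk_def)
  have "x \<noteq> pole_pt" using x w(1) by (auto simp: wcoord_pole_pt)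
  then have crit: "is_critical_point n \<xi> zs x" using x w(3) by (simp add: is_critical_point_def)
  show ?thesis
  proof (intro ex1I[of _ x] conjI xd crit)
    fix y assume y: "y \<in> geo_disk W (r / N) \<and> is_critical_point n \<xi> zs y"
    then have "wcoord y = w" using chart[of y] by (intro uniq) (auto simp: is_critical_point_def)
    moreover have "y \<in> S2 - {origin_pt}" using y by (auto simp: is_critical_point_def)
    ultimately show "y = x" using wcoord_eq_iff[of y x] x by simp
  qed
qed

theorem theorem1:
  fixes \<mu> :: "(real^3) measure" and \<xi> :: "real^3" and r \<delta> :: real
    and D :: "nat set" and W :: "nat \<Rightarrow> real^3"
  assumes "prob_space \<mu>" and "has_bounded_density \<mu>"
    and "\<xi> \<in> S2 - exceptional_set \<mu>"
    and "averaged_critical_point \<mu> \<xi> D W"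
    and "r > 0"
    and "\<forall>N\<in>D. \<xi> \<notin> geo_circle (W N) (r / real N)"
    and "0 < \<delta>" and "\<delta> < 1"
  shows "\<exists>C>0. \<forall>N\<in>D.
    measure (Pi\<^sub>M {1..N-1} (\<lambda>_. \<mu>))
      {zs \<in> space (Pi\<^sub>M {1..N-1} (\<lambda>_. \<mu>)).
         \<exists>!x. x \<in> geo_disk (W N) (r / real N) \<and> is_critical_point N \<xi> zs x}
      \<ge> 1 - C * real N powr (- \<delta>)"
proof -
  obtain K where "S2_measure \<mu> K"
    using has_bounded_density_S2_measure[OF assms(1,2)] .
  then interpret S2_measure \<mu> K .
  note r = \<open>r > 0\<close> and \<delta> = \<open>0 < \<delta>\<close> \<open>\<delta> < 1\<close>
  define x0 where "x0 = wcoord \<xi>"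
  define p where "p = phi \<mu> x0"
  define a where "a = - 1 / x0 + p"
  have \<xi>: "\<xi> \<in> S2 - {origin_pt}" "\<xi> \<noteq> pole_pt" and a: "a \<noteq> 0"
    using assms(3) by (auto simp: exceptional_set_def a_def p_def x0_def)
  then have x0: "x0 \<noteq> 0" using wcoord_eq_0_iff unfolding x0_def by blast
  have WD: "N \<ge> 1" "W N \<in> S2 - {origin_pt}" if "N \<in> D" for N
    using assms(4) that by (auto simp: averaged_critical_point_def)
  obtain b where b: "b > 0" "\<And>N. N \<in> D \<Longrightarrow> sdist (W N) \<xi> \<le> b / N"
    using assms(4) by (auto simp: averaged_critical_point_def)
  define c where "c = (1 - \<xi> $ 3) / 2"
  have c: "c > 0" using S2_third_less_1[of \<xi>] \<xi> by (auto simp: c_def)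
  \<comment> \<open>The first entry is demanded by the fixed point argument; the second makes the
    coordinate disk of radius \<open>R / N\<close> contain the image of the geodesic disk, whose
    points lie within \<open>(r + b) / N\<close> of \<open>\<xi>\<close>.\<close>
  define R where "R = max (2 / cmod a) ((r + b) / c)"
  have R: "2 / cmod a \<le> R" "(r + b) / c \<le> R" by (auto simp: R_def)
  have R0: "R > 0" using a R(1) by (smt (verit) divide_pos_pos zero_less_norm_iff)
  \<comment> \<open>The random critical point and the averaged one will each be within
    \<open>r / 10 / N\<close> of \<open>x0 - 1 / (N * a)\<close>, and two such errors stay below
    \<open>r / 4 / N\<close>.\<close>
  define e where "e = min (cmod a / 2) (r / 10 * (cmod a)\<^sup>2 / 4)"
  have e: "e > 0" "e \<le> cmod a / 2" "4 * e / (cmod a)\<^sup>2 \<le> r / 10"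
    using a r by (auto simp: e_def min_def field_simps)
  \<comment> \<open>The two entries give \<open>16 * \<eta> * R + \<eta>\<close> at most
    \<open>e / 2\<close> and \<open>8 * (16 * \<eta>)\<close> at most half of
    \<open>(cmod a)\<^sup>2\<close>. The remaining halves absorb the part of \<open>L N\<close> that
    tends to 0.\<close>
  define \<eta> where "\<eta> = min (e / (2 * (16 * R + 1))) ((cmod a)\<^sup>2 / 256)"
  have \<eta>: "\<eta> > 0" using e a R0 by (auto simp: \<eta>_def)
  have "\<eta> \<le> e / (2 * (16 * R + 1))" by (simp add: \<eta>_def)
  then have \<eta>e: "16 * \<eta> * R + \<eta> < e"
    using e R0 by (simp add: field_simps)
  have \<eta>a: "8 * (16 * \<eta>) < (cmod a)\<^sup>2"
  proof -
    have "\<eta> \<le> (cmod a)\<^sup>2 / 256" unfolding \<eta>_def by (rule min.cobounded2)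
    moreover have "(cmod a)\<^sup>2 > 0" using a by simp
    ultimately show ?thesis by linarith
  qed
  define L where "L N = 4 / ((cmod x0)\<^sup>2 * real N) + 16 * \<eta>" for N :: nat
  have L_lim: "L \<longlonglongrightarrow> 16 * \<eta>"
    unfolding L_def using x0 by real_asymp
  have L1: "\<forall>\<^sub>F N in sequentially. L N * R + \<eta> < e"
    using \<eta>e by (intro order_tendstoD(2)[OF tendsto_add[OF tendsto_mult[OF L_lim tendsto_const] tendsto_const]])
  have L2: "\<forall>\<^sub>F N in sequentially. 8 * L N < (cmod a)\<^sup>2"
    using \<eta>a by (intro order_tendstoD(2)[OF tendsto_mult[OF tendsto_const L_lim]])
  have small: "\<forall>\<^sub>F N in sequentially. s / real N < t" if "t > 0" for s t :: real
  proof -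
    have "(\<lambda>N. s / real N) \<longlonglongrightarrow> 0" by real_asymp
    then show ?thesis using that by (rule order_tendstoD(2))
  qed
  have S: "\<forall>\<^sub>F N in sequentially. R / real N < cmod x0 / 2"
    "\<forall>\<^sub>F N in sequentially. r / real N < pi"
    "\<forall>\<^sub>F N in sequentially. (r + b) / real N < c"
    using x0 c by (intro small; simp)+
  have M: "\<forall>\<^sub>F N in sequentially. \<eta> / 2 + 2 * (4 * R / real N) powr \<delta> * moment_bound (1 + \<delta>) + cmod p / real N < \<eta>"
  proof -
    have p1: "(\<lambda>N. (4 * R / real N) powr \<delta>) \<longlonglongrightarrow> 0" using R0 \<delta> by real_asymp
    have p2: "(\<lambda>N. cmod p / real N) \<longlonglongrightarrow> 0" by real_asymp
    have "(\<lambda>N. \<eta> / 2 + 2 * (4 * R / real N) powr \<delta> * moment_bound (1 + \<delta>) + cmod p / real N)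
        \<longlonglongrightarrow> \<eta> / 2 + 2 * 0 * moment_bound (1 + \<delta>) + 0"
      by (intro tendsto_add tendsto_mult tendsto_const p1 p2)
    then show ?thesis by (rule order_tendstoD(2)) (use \<eta> in simp)
  qed
  have asymp: "\<forall>\<^sub>F N in sequentially. N \<in> D \<longrightarrow> cmod (wcoord (W N) - (x0 - 1 / (of_nat N * a))) \<le> r / 10 / N"
    using averaged_critical_point_asymp[OF assms(3,4), of "r / 10"] r by (simp add: a_def p_def x0_def)
  \<comment> \<open>The radius \<open>4 * R\<close> is the separation that
    \<open>kern_Lipschitz\<close> needs on a disk of radius \<open>R / N\<close>. Using
    \<open>\<eta> / 2\<close> leaves room for the deterministic errors, which \<open>M\<close> makes
    eventually less than \<open>\<eta> / 2\<close>.\<close>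
  have pos: "4 * R > 0" "\<eta> / 2 > 0" using R0 \<eta> by auto
  obtain C where C: "\<forall>N\<ge>(1::nat). \<exists>B \<in> sets (Pi\<^sub>M {1..N-(1::nat)} (\<lambda>_. \<mu>)).
     measure (Pi\<^sub>M {1..N-(1::nat)} (\<lambda>_. \<mu>)) B \<le> C * N powr (- \<delta>) \<and>
     (\<forall>z \<in> space (Pi\<^sub>M {1..N-(1::nat)} (\<lambda>_. \<mu>)) - B.
        (\<forall>j\<in>{1..N-(1::nat)}. z j \<in> S2 \<and> 4 * R / N < norm (\<xi> - z j)) \<and>
        (\<Sum>j=1..N-(1::nat). norm (\<xi> - z j) powr (- 2)) \<le> \<eta> / 2 * (real N)\<^sup>2 \<and>
        cmod ((\<Sum>j=1..N-(1::nat). kern (wcoord \<xi>) (z j)) / N - phi \<mu> (wcoord \<xi>)) \<le>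
          \<eta> / 2 + 2 * (4 * R / N) powr \<delta> * moment_bound (1 + \<delta>) + cmod (phi \<mu> (wcoord \<xi>)) / N)"
    using good_configurations[OF \<xi>(1) pos \<delta>] by (rule exE)
  define E where "E N = {zs \<in> space (Pi\<^sub>M {1..N-1} (\<lambda>_. \<mu>)).
         \<exists>!x. x \<in> geo_disk (W N) (r / real N) \<and> is_critical_point N \<xi> zs x}" for N
  have "\<forall>\<^sub>F N in sequentially. N \<in> D \<longrightarrow> measure (Pi\<^sub>M {1..N-1} (\<lambda>_. \<mu>)) (E N) \<ge> 1 - C * real N powr (- \<delta>)"
    using L1 L2 M asymp S
  proof eventually_elim
    case (elim N)
    show ?case
    proof
      assume N: "N \<in> D"
      have N1: "N \<ge> 1" and N0: "real N > 0" using WD(1)[OF N] by auto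
      define P where "P = Pi\<^sub>M {1..N-1} (\<lambda>_. \<mu>)"
      interpret P: prob_space P unfolding P_def by (rule prob_space_PiM_const)
      obtain B where B: "B \<in> sets P" "measure P B \<le> C * N powr (- \<delta>)"
        and good: "\<And>z. z \<in> space P - B \<Longrightarrow> (\<forall>j\<in>{1..N-1}. z j \<in> S2 \<and> 4 * R / N < norm (\<xi> - z j)) \<and>
        (\<Sum>j=1..N-1. norm (\<xi> - z j) powr (- 2)) \<le> \<eta> / 2 * (real N)\<^sup>2 \<and>
        cmod ((\<Sum>j=1..N-1. kern (wcoord \<xi>) (z j)) / N - phi \<mu> (wcoord \<xi>)) \<le>
          \<eta> / 2 + 2 * (4 * R / N) powr \<delta> * moment_bound (1 + \<delta>) + cmod (phi \<mu> (wcoord \<xi>)) / N"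
        using C[rule_format, OF N1] unfolding P_def by blast
      have chart: "x \<noteq> origin_pt \<and> wcoord x \<in> cball x0 (R / N)" if x: "x \<in> geo_disk (W N) (r / N)" for x
      proof -
        have xS: "x \<in> S2" "sdist (W N) x < r / N" using x by (auto simp: geo_disk_def)
        have "norm (x - \<xi>) \<le> norm (W N - x) + norm (W N - \<xi>)"
          using norm_triangle_ineq4[of "W N - \<xi>" "W N - x"] by simp
        also have "\<dots> \<le> sdist (W N) x + sdist (W N) \<xi>"
          using WD(2)[OF N] xS \<xi> by (intro add_mono norm_le_sdist) auto
        also have "\<dots> \<le> (r + b) / N"
          using xS(2) b(2)[OF N] by (simp add: add_divide_distrib)
        finally have n: "norm (x - \<xi>) \<le> (r + b) / N" .
        then have "norm (x - \<xi>) \<le> c" using elim(7) by linarith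
        then have nc: "norm (x - \<xi>) \<le> (1 - \<xi> $ 3) / 2" by (simp add: c_def)
        have "cmod (wcoord x - x0) \<le> norm (x - \<xi>) / c"
          unfolding x0_def c_def by (rule wcoord_near(2)[OF \<xi>(1) xS(1) nc])
        also have "\<dots> \<le> (r + b) / N / c" using n c by (intro divide_right_mono) auto
        also have "\<dots> = (r + b) / c / N" by simp
        also have "\<dots> \<le> R / N" using R(2) by (intro divide_right_mono) auto
        finally show ?thesis
          using wcoord_near(1)[OF \<xi>(1) xS(1) nc] by (simp add: dist_norm norm_minus_commute)
      qed
      \<comment> \<open>Outside the bad set the deterministic criterion applies, so the complement
        of \<open>B\<close> lies in the event.\<close>
      have sub: "space P - B \<subseteq> E N"
      proof
        fix zs assume zs: "zs \<in> space P - B"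
        have far: "\<And>j. j \<in> {1..N-1} \<Longrightarrow> zs j \<in> S2 \<and> 4 * (R / N) < norm (\<xi> - zs j)"
          using good[OF zs] by auto
        have "\<eta> / 2 * (real N)\<^sup>2 \<le> \<eta> * (real N)\<^sup>2" using \<eta> by (intro mult_right_mono) auto
        then have sq: "(\<Sum>j=1..N-1. norm (\<xi> - zs j) powr (- 2)) \<le> \<eta> * (real N)\<^sup>2"
          using good[OF zs] by linarith
        have lln: "cmod ((\<Sum>j=1..N-1. kern x0 (zs j)) / N - p) \<le> \<eta>"
          using good[OF zs] elim(3) by (simp add: p_def x0_def)
        have e': "L N * R + \<eta> \<le> cmod a / 2"
          using elim(1) e(2) by linarith
        obtain w where w: "w \<in> cball x0 (R / N)" "w \<noteq> 0" "deriv (rpoly N \<xi> zs) w = 0"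
          "\<And>v. v \<in> cball x0 (R / N) \<Longrightarrow> deriv (rpoly N \<xi> zs) v = 0 \<Longrightarrow> v = w"
          "cmod (w - (x0 - 1 / (of_nat N * a))) \<le> 4 * (L N * R + \<eta>) / ((cmod a)\<^sup>2 * N)"
          using unique_critical_coordinate[where p = p and N = N and R = R and \<eta> = \<eta> and \<xi> = \<xi> and zs = zs,
              folded x0_def, folded a_def L_def, OF N1 \<xi>(1) x0 a R(1) less_imp_le[OF \<eta>] far
              less_imp_le[OF elim(5)] sq lln e' less_imp_le[OF elim(2)]]
          by blast
        have "cmod (w - wcoord (W N)) \<le> cmod (w - (x0 - 1 / (of_nat N * a))) +
            cmod (wcoord (W N) - (x0 - 1 / (of_nat N * a)))"
          using norm_triangle_ineq4[of "w - (x0 - 1 / (of_nat N * a))" "wcoord (W N) - (x0 - 1 / (of_nat N * a))"]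
          by simp
        also have "\<dots> \<le> 4 * e / (cmod a)\<^sup>2 / N + r / 10 / N"
        proof (rule add_mono)
          have "4 * (L N * R + \<eta>) / ((cmod a)\<^sup>2 * N) \<le> 4 * e / ((cmod a)\<^sup>2 * N)"
            using elim(1) by (intro divide_right_mono) auto
          with w(5) show "cmod (w - (x0 - 1 / (of_nat N * a))) \<le> 4 * e / (cmod a)\<^sup>2 / N" by simp
        qed (use elim(4) N in simp)
        also have "\<dots> \<le> r / 10 / N + r / 10 / N"
          using e(3) by (intro add_right_mono divide_right_mono) auto
        also have "\<dots> < r / 4 / N" using r N0 by (simp add: field_simps)
        finally have "\<exists>!x. x \<in> geo_disk (W N) (r / N) \<and> is_critical_point N \<xi> zs x"
          by (intro ex1_critical_point_in_disk[OF WD(2)[OF N] N0 r chart w(2,1,3,4)])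
        then show "zs \<in> E N" using zs by (simp add: E_def P_def)
      qed
      have "E N \<in> sets P"
        unfolding E_def P_def using WD(2)[OF N] r N0 elim(6)
        by (intro measurable_unique_critical_point) auto
      then have "measure P (space P - B) \<le> measure P (E N)"
        using sub by (intro P.finite_measure_mono)
      then show "measure (Pi\<^sub>M {1..N-1} (\<lambda>_. \<mu>)) (E N) \<ge> 1 - C * real N powr (- \<delta>)"
        using B P.prob_compl[OF B(1)] by (simp add: P_def)
    qed
  qed
  then obtain N0 where N0: "\<And>N. N \<ge> N0 \<Longrightarrow> N \<in> D \<Longrightarrow>
      measure (Pi\<^sub>M {1..N-1} (\<lambda>_. \<mu>)) (E N) \<ge> 1 - C * real N powr (- \<delta>)"
    unfolding eventually_sequentially by blast
  \<comment> \<open>The first entry replaces \<open>C\<close>, whose sign is unknown, for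
    \<open>N\<close> from \<open>N0\<close> on. The second makes the claimed lower bound nonpositive
    for the finitely many smaller \<open>N\<close>, and is itself positive.\<close>
  define C' where "C' = max \<bar>C\<bar> (real (N0 + 1) powr \<delta>)"
  show ?thesis
  proof (intro exI[of _ C'] conjI ballI)
    show "C' > 0" by (simp add: C'_def less_max_iff_disj)
    fix N assume N: "N \<in> D"
    have N1: "real N > 0" using WD(1)[OF N] by simp
    have "1 - C' * real N powr (- \<delta>) \<le> measure (Pi\<^sub>M {1..N-1} (\<lambda>_. \<mu>)) (E N)"
    proof (cases "N0 \<le> N")
      case True
      have "C * real N powr (- \<delta>) \<le> C' * real N powr (- \<delta>)"
        by (intro mult_right_mono) (auto simp: C'_def)
      then show ?thesis using N0[OF True N] by linarith
    next
      case False
      then have "real N powr \<delta> \<le> real (N0 + 1) powr \<delta>" using \<delta> by (intro powr_mono2) auto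
      then have "real N powr \<delta> \<le> C'" by (simp add: C'_def)
      then have "1 \<le> C' * real N powr (- \<delta>)" using N1 by (simp add: powr_minus_divide)
      then show ?thesis using measure_nonneg[of "Pi\<^sub>M {1..N-1} (\<lambda>_. \<mu>)" "E N"] by linarith
    qed
    then show "measure (Pi\<^sub>M {1..N-1} (\<lambda>_. \<mu>))
      {zs \<in> space (Pi\<^sub>M {1..N-1} (\<lambda>_. \<mu>)).
         \<exists>!x. x \<in> geo_disk (W N) (r / real N) \<and> is_critical_point N \<xi> zs x}
      \<ge> 1 - C' * real N powr (- \<delta>)"
      by (simp add: E_def)
  qed
qed

end
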